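(* (First Euler theorem.) Let $\nu$ be a real-valued function in a simply connected domain $\Omega\subset\mathbb{C}$, and let $Q_0$ be a bounded particular solution in $\Omega$ of the complex differential Riccati equation $$\partial_{\overline z}Q+|Q|^2=\frac{\nu}{4}.\qquad (R)$$ Then $(R)$ reduces to the following first-order (real-linear) equation $$W_{\overline z}=\overline{Q_0W}\qquad (V)$$ in the following sense. Any solution $Q$ of $(R)$ has the form $$Q=\frac{\partial_z\operatorname{Re}W}{\operatorname{Re}W},$$ where $W$ is a solution of $(V)$, and vice versa, any solution $W$ of $(V)$ can be expressed via a corresponding solution $Q$ of $(R)$ as follows: $$W=e^{A[Q]}+i\,e^{-A[Q_0]}\,\overline{A}\left[\,i\,e^{2A[Q_0]}\,\partial_{\overline z}e^{A[Q-Q_0]}\right].$$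
   Context: Here $z=x+iy$, $\partial_{\overline z}=\frac12(\partial_x+i\partial_y)$, $\partial_z=\frac12(\partial_x-i\partial_y)$, and $W_{\overline z}=\partial_{\overline z}W$. The functions $Q$, $W$ are complex-valued and are not assumed to be analytic; the bar over a function denotes complex conjugation. The operators $A$ and $\overline{A}$ are defined as follows. Let $\Phi=\Phi_1+i\Phi_2$ (with $\Phi_1,\Phi_2$ real-valued) be a complex-valued function in a simply connected domain, let $\Gamma$ be an arbitrary rectifiable curve in the domain leading from a fixed point $(x_0,y_0)$ to $(x,y)$, and let $c$ be an arbitrary real constant. If $\partial_y\Phi_1+\partial_x\Phi_2=0$, then $$A[\Phi](x,y)=2\int_{\Gamma}(\Phi_1\,dx-\Phi_2\,dy)+c,$$ a real-valued function with $\partial_zA[\Phi]=\Phi$. If $\partial_y\Phi_1-\partial_x\Phi_2=0$, then $$\overline{A}[\Phi](x,y)=2\int_{\Gamma}(\Phi_1\,dx+\Phi_2\,dy)+c,$$ a real-valued function with $\partial_{\overline z}\overline{A}[\Phi]=\Phi$. Thus $A[\Phi]$ and $\overline{A}[\Phi]$ are determined up to an additive real constant. Every solution $Q=Q_1+iQ_2$ of $(R)$ satisfies $\partial_yQ_1+\partial_xQ_2=0$, so $A$ is applicable to it.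
   Formalization: Solutions are read as C1. In the converse, W is assumed to have Re W nowhere zero in Ω and the formula for W carries a factor sgn(Re W), since Re of the printed right side is e^{A[Q]}>0; e.g. W=i e^{-A[Q_0]} solves (V) but has Re W=0. *)

theory Defs
  imports "HOL-Analysis.Analysis"
begin

definition partial_x :: "(complex \<Rightarrow> 'a::real_normed_vector) \<Rightarrow> complex \<Rightarrow> 'a" where
  "partial_x f z = vector_derivative (\<lambda>t::real. f (z + of_real t)) (at 0)"

definition partial_y :: "(complex \<Rightarrow> 'a::real_normed_vector) \<Rightarrow> complex \<Rightarrow> 'a" where
  "partial_y f z = vector_derivative (\<lambda>t::real. f (z + \<i> * of_real t)) (at 0)"

definition d_z :: "(complex \<Rightarrow> complex) \<Rightarrow> complex \<Rightarrow> complex" where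
  "d_z f z = (partial_x f z - \<i> * partial_y f z) / 2"

definition d_zbar :: "(complex \<Rightarrow> complex) \<Rightarrow> complex \<Rightarrow> complex" where
  "d_zbar f z = (partial_x f z + \<i> * partial_y f z) / 2"

(* Differentiability is over the reals (Frechet); the set is meant to be open. *)
definition C1_on :: "complex set \<Rightarrow> (complex \<Rightarrow> complex) \<Rightarrow> bool" where
  "C1_on \<Omega> f \<longleftrightarrow> (\<forall>z\<in>\<Omega>. f differentiable (at z)) \<and>
     continuous_on \<Omega> (partial_x f) \<and> continuous_on \<Omega> (partial_y f)"

(* Every K in a division of {0..1} is a nonempty closed interval {Inf K..Sup K}. *)
definition rectifiable_curve :: "(real \<Rightarrow> complex) \<Rightarrow> bool" where
  "rectifiable_curve \<gamma> \<longleftrightarrow> path \<gamma> \<and>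
     (\<exists>L. \<forall>D. D division_of {0..1} \<longrightarrow> (\<Sum>K\<in>D. dist (\<gamma> (Inf K)) (\<gamma> (Sup K))) \<le> L)"

(* The integral of P dx + R dy along gamma has the value I: a limit of Riemann-Stieltjes sums
   over tagged partitions whose mesh tends to 0, as gamma need not be differentiable. *)
definition has_line_integral ::
  "(complex \<Rightarrow> real) \<Rightarrow> (complex \<Rightarrow> real) \<Rightarrow> (real \<Rightarrow> complex) \<Rightarrow> real \<Rightarrow> bool" where
  "has_line_integral P R \<gamma> I \<longleftrightarrow>
     (\<forall>e>0. \<exists>\<delta>>0. \<forall>D. D tagged_division_of {0..1} \<and> (\<lambda>t. ball t \<delta>) fine D \<longrightarrow>
        \<bar>(\<Sum>(t, K)\<in>D. P (\<gamma> t) * (Re (\<gamma> (Sup K)) - Re (\<gamma> (Inf K)))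
                    + R (\<gamma> t) * (Im (\<gamma> (Sup K)) - Im (\<gamma> (Inf K)))) - I\<bar> < e)"

(* The operators A and A-bar are determined only up to an additive real constant, so they are
   rendered as relations: "a is one of the functions A[Phi]" on Omega. They apply only to
   functions satisfying the respective compatibility condition. *)
definition is_A :: "complex set \<Rightarrow> (complex \<Rightarrow> complex) \<Rightarrow> (complex \<Rightarrow> real) \<Rightarrow> bool" where
  "is_A \<Omega> \<Phi> a \<longleftrightarrow> C1_on \<Omega> \<Phi> \<and>
     (\<forall>z\<in>\<Omega>. partial_y (\<lambda>w. Re (\<Phi> w)) z + partial_x (\<lambda>w. Im (\<Phi> w)) z = 0) \<and>
     (\<exists>z0\<in>\<Omega>. \<exists>c. \<forall>z\<in>\<Omega>. \<forall>\<Gamma>. rectifiable_curve \<Gamma> \<and> path_image \<Gamma> \<subseteq> \<Omega> \<and>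
        pathstart \<Gamma> = z0 \<and> pathfinish \<Gamma> = z \<longrightarrow>
        (\<exists>I. has_line_integral (\<lambda>w. Re (\<Phi> w)) (\<lambda>w. - Im (\<Phi> w)) \<Gamma> I \<and> a z = 2 * I + c))"

definition is_A_bar :: "complex set \<Rightarrow> (complex \<Rightarrow> complex) \<Rightarrow> (complex \<Rightarrow> real) \<Rightarrow> bool" where
  "is_A_bar \<Omega> \<Phi> a \<longleftrightarrow> C1_on \<Omega> \<Phi> \<and>
     (\<forall>z\<in>\<Omega>. partial_y (\<lambda>w. Re (\<Phi> w)) z - partial_x (\<lambda>w. Im (\<Phi> w)) z = 0) \<and>
     (\<exists>z0\<in>\<Omega>. \<exists>c. \<forall>z\<in>\<Omega>. \<forall>\<Gamma>. rectifiable_curve \<Gamma> \<and> path_image \<Gamma> \<subseteq> \<Omega> \<and>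
        pathstart \<Gamma> = z0 \<and> pathfinish \<Gamma> = z \<longrightarrow>
        (\<exists>I. has_line_integral (\<lambda>w. Re (\<Phi> w)) (\<lambda>w. Im (\<Phi> w)) \<Gamma> I \<and> a z = 2 * I + c))"

definition riccati_solution ::
  "complex set \<Rightarrow> (complex \<Rightarrow> real) \<Rightarrow> (complex \<Rightarrow> complex) \<Rightarrow> bool" where
  "riccati_solution \<Omega> \<nu> Q \<longleftrightarrow> C1_on \<Omega> Q \<and>
     (\<forall>z\<in>\<Omega>. d_zbar Q z + of_real ((cmod (Q z))\<^sup>2) = of_real (\<nu> z / 4))"

definition vekua_solution ::
  "complex set \<Rightarrow> (complex \<Rightarrow> complex) \<Rightarrow> (complex \<Rightarrow> complex) \<Rightarrow> bool" where
  "vekua_solution \<Omega> Q0 W \<longleftrightarrow> C1_on \<Omega> W \<and>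
     (\<forall>z\<in>\<Omega>. d_zbar W z = cnj (Q0 z * W z))"

end

theory Submission
  imports Defs "HOL-Complex_Analysis.Complex_Analysis"
begin

text \<open>
  Let \<open>a0\<close> be \<open>A[Q0]\<close>, and write \<open>W = exp a0 * u + i * exp (- a0) * v\<close> with real \<open>u\<close> and \<open>v\<close>. The Vekua equation
  becomes \<open>d_zbar v = i * exp (2 * a0) * d_zbar u\<close>, that is, \<open>v = A-bar[i * exp (2 * a0) * d_zbar u]\<close>, and
  the Riccati equations of \<open>Q\<close> and \<open>Q0\<close> say precisely that the form on the right is closed when
  \<open>u = exp A[Q - Q0]\<close>. Potentials on a simply connected domain are obtained from those on a disc by
  the Riemann mapping theorem.

  The delicate point is the converse direction: \<open>W\<close> is only of class \<open>C1\<close>, while \<open>Q = d_z (Re W) / Re W\<close> has to be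
  of class \<open>C1\<close> as well. As \<open>Q = Q0 + d_z u / u\<close>, one must show that \<open>d_z u\<close> is continuously differentiable.
  This is elliptic regularity in two steps: the Cauchy transform of a Hoelder continuous function has
  Hoelder continuous first derivatives, so \<open>W = Cauchy transform + holomorphic\<close> makes \<open>d_z W\<close>, and
  hence \<open>q = d_z u\<close>, Hoelder continuous; and \<open>q\<close> satisfies
  \<open>d_zbar q = - 2 * Re (cnj Q0 * q)\<close> in a weak sense, so it too is the Cauchy transform of a
  Hoelder continuous function up to a holomorphic function.
\<close>

section \<open>Wirtinger derivatives\<close>

text \<open>The weights come from the equation: \<open>exp a0\<close> and
  \<open>\<i> * exp (- a0)\<close> both solve (V) (a generating pair in the sense of Bers), so with
  \<open>W\<close> written in this pair only derivatives of \<open>u\<close> and \<open>v\<close>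
  survive. Two obstacles shape the regularity part. The Cauchy transform of a merely continuous
  function need not be of class C1, hence the Hoelder estimates. And \<open>W\<close> cannot simply
  be bootstrapped: formally \<open>d_zbar (d_z W)\<close> contains \<open>d_zbar Q0 * cnj W\<close>,
  where \<open>d_zbar Q0\<close> is only continuous. In \<open>d_z W - Q0 * cnj W\<close>, which is
  \<open>q\<close> up to the factor \<open>exp (- a0) / 2\<close>, this term cancels, because the
  Riccati equation makes \<open>d_zbar Q0\<close> real. What remains on the right involves only
  \<open>Q0\<close> and \<open>q\<close>, both Hoelder continuous. Each use of the Cauchy transform
  costs half of the exponent: \<open>d_zbar W\<close> is locally Lipschitz, so \<open>d_z W\<close>
  and \<open>q\<close> have exponent 1/2, and the derivative of the second transform has 1/4. Any
  positive exponent would do at the end, so the sharp loss-free estimate can be avoided.\<close>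

text \<open>\<^term>\<open>A\<close> and \<^term>\<open>B\<close> are the Wirtinger derivatives of \<^term>\<open>f\<close> at \<^term>\<open>z\<close>: every real-linear map on the
  complex numbers has the form \<^term>\<open>\<lambda>h. A * h + B * cnj h\<close>.\<close>

definition has_wirt :: "(complex \<Rightarrow> complex) \<Rightarrow> complex \<Rightarrow> complex \<Rightarrow> complex \<Rightarrow> bool" where
  "has_wirt f A B z \<longleftrightarrow> (f has_derivative (\<lambda>h. A * h + B * cnj h)) (at z)"

lemma has_wirt_cong:
  assumes "has_wirt f A B z" "open S" "z \<in> S" "\<And>w. w \<in> S \<Longrightarrow> f w = g w"
  shows "has_wirt g A B z"
  unfolding has_wirt_def
  by (rule has_derivative_transform_within_open[OF assms(1)[unfolded has_wirt_def] assms(2,3)])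
     (rule assms(4))

lemma has_wirt_eq: "has_wirt f A B z \<Longrightarrow> A = A' \<Longrightarrow> B = B' \<Longrightarrow> has_wirt f A' B' z"
  by simp

lemma has_wirt_const: "has_wirt (\<lambda>z. c) 0 0 z"
  unfolding has_wirt_def by simp

lemma has_wirt_ident: "has_wirt (\<lambda>z. z) 1 0 z"
  unfolding has_wirt_def by (auto intro!: derivative_eq_intros)

lemma has_wirt_add:
  assumes "has_wirt f A B z" "has_wirt g A' B' z"
  shows "has_wirt (\<lambda>z. f z + g z) (A + A') (B + B') z"
  unfolding has_wirt_def
  by (rule has_derivative_eq_rhs[OF has_derivative_add[OF assms[unfolded has_wirt_def]]]) (simp add: fun_eq_iff algebra_simps)

lemma has_wirt_diff:
  assumes "has_wirt f A B z" "has_wirt g A' B' z"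
  shows "has_wirt (\<lambda>z. f z - g z) (A - A') (B - B') z"
  unfolding has_wirt_def
  by (rule has_derivative_eq_rhs[OF has_derivative_diff[OF assms[unfolded has_wirt_def]]]) (simp add: fun_eq_iff algebra_simps)

lemma has_wirt_mult:
  assumes "has_wirt f A B z" "has_wirt g A' B' z"
  shows "has_wirt (\<lambda>z. f z * g z) (A * g z + f z * A') (B * g z + f z * B') z"
  unfolding has_wirt_def
  by (rule has_derivative_eq_rhs[OF has_derivative_mult[OF assms[unfolded has_wirt_def]]]) (simp add: fun_eq_iff algebra_simps)

lemma has_wirt_cmult:
  assumes "has_wirt f A B z"
  shows "has_wirt (\<lambda>z. c * f z) (c * A) (c * B) z"
  using has_wirt_mult[OF has_wirt_const assms] by simp

lemma has_wirt_cnj: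
  assumes "has_wirt f A B z"
  shows "has_wirt (\<lambda>z. cnj (f z)) (cnj B) (cnj A) z"
  unfolding has_wirt_def
  by (rule has_derivative_eq_rhs[OF has_derivative_cnj[OF assms[unfolded has_wirt_def]]]) (simp add: fun_eq_iff algebra_simps)

lemma has_wirt_field_comp:
  assumes "has_wirt f A B z" "(g has_field_derivative D) (at (f z))"
  shows "has_wirt (\<lambda>z. g (f z)) (D * A) (D * B) z"
proof -
  have "(g has_derivative (*) D) (at (f z))"
    using assms(2) by (simp add: has_field_derivative_def)
  from has_derivative_compose[OF assms(1)[unfolded has_wirt_def] this]
  show ?thesis unfolding has_wirt_def by (simp add: algebra_simps)
qed

lemma has_wirt_comp_field:
  assumes "has_wirt f A B (g z)" "(g has_field_derivative D) (at z)"
  shows "has_wirt (\<lambda>z. f (g z)) (A * D) (B * cnj D) z"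
proof -
  have "(g has_derivative (*) D) (at z)"
    using assms(2) by (simp add: has_field_derivative_def)
  from has_derivative_compose[OF this assms(1)[unfolded has_wirt_def]]
  show ?thesis unfolding has_wirt_def by (simp add: algebra_simps)
qed

lemma has_wirt_of_field: "(g has_field_derivative D) (at z) \<Longrightarrow> has_wirt g D 0 z"
  using has_wirt_field_comp[OF has_wirt_ident, of g D z] by simp

lemma has_field_derivative_of_wirt: "has_wirt g D 0 z \<Longrightarrow> (g has_field_derivative D) (at z)"
  unfolding has_wirt_def has_field_derivative_def
  by (erule has_derivative_eq_rhs) (simp add: fun_eq_iff)

lemma has_wirt_exp:
  "has_wirt f A B z \<Longrightarrow> has_wirt (\<lambda>z. exp (f z)) (exp (f z) * A) (exp (f z) * B) z"
  by (rule has_wirt_field_comp[OF _ DERIV_exp])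

lemma has_wirt_inverse:
  "has_wirt f A B z \<Longrightarrow> f z \<noteq> 0 \<Longrightarrow>
    has_wirt (\<lambda>z. inverse (f z)) (- A / (f z)\<^sup>2) (- B / (f z)\<^sup>2) z"
  by (rule has_wirt_eq[OF has_wirt_field_comp[OF _ DERIV_inverse]])
     (simp_all add: power2_eq_square divide_inverse)

lemma has_wirt_Re:
  assumes "has_wirt f A B z"
  shows "has_wirt (\<lambda>z. complex_of_real (Re (f z))) ((A + cnj B) / 2) ((B + cnj A) / 2) z"
  using has_wirt_cmult[OF has_wirt_add[OF assms has_wirt_cnj[OF assms]], of "1/2"]
  by (simp add: complex_add_cnj)

lemma has_wirt_Im:
  assumes "has_wirt f A B z"
  shows "has_wirt (\<lambda>z. complex_of_real (Im (f z))) (\<i> * (cnj B - A) / 2) (\<i> * (cnj A - B) / 2) z"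
  by (rule has_wirt_eq[OF has_wirt_Re[OF has_wirt_cmult[OF assms, of "- \<i>"], simplified]])
     (simp_all add: algebra_simps)

lemma has_wirt_isCont: "has_wirt f A B z \<Longrightarrow> isCont f z"
  unfolding has_wirt_def by (rule has_derivative_continuous)

lemma continuous_on_has_wirt:
  "(\<And>z. z \<in> S \<Longrightarrow> has_wirt f (A z) (B z) z) \<Longrightarrow> continuous_on S f"
  by (intro continuous_at_imp_continuous_on ballI has_wirt_isCont)

text \<open>Mean value inequality: \<open>cmod A + cmod B\<close> dominates the operator norm of the
  derivative.\<close>

lemma has_wirt_norm_le:
  fixes f :: "complex \<Rightarrow> complex"
  assumes "convex S" "\<And>z. z \<in> S \<Longrightarrow> has_wirt f (A z) (B z) z"
    "\<And>z. z \<in> S \<Longrightarrow> cmod (A z) + cmod (B z) \<le> L" "x \<in> S" "y \<in> S"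
  shows "cmod (f x - f y) \<le> L * cmod (x - y)"
proof (rule differentiable_bound[OF assms(1), where f' = "\<lambda>z h. A z * h + B z * cnj h"])
  fix z assume z: "z \<in> S"
  show "(f has_derivative (\<lambda>h. A z * h + B z * cnj h)) (at z within S)"
    using assms(2)[OF z] has_derivative_at_withinI unfolding has_wirt_def by blast
  show "onorm (\<lambda>h. A z * h + B z * cnj h) \<le> L"
  proof (rule onorm_le)
    fix h
    have "cmod (A z * h + B z * cnj h) \<le> cmod (A z) * cmod h + cmod (B z) * cmod h"
      by (metis complex_mod_cnj norm_mult norm_triangle_ineq)
    also have "\<dots> \<le> L * cmod h"
      using mult_right_mono[OF assms(3)[OF z] norm_ge_zero[of h]] by (simp add: distrib_right)
    finally show "cmod (A z * h + B z * cnj h) \<le> L * cmod h" .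
  qed
qed (use assms in auto)

lemma has_vector_derivative_line:
  fixes f :: "complex \<Rightarrow> 'a::real_normed_vector"
  assumes "(f has_derivative f') (at z)"
  shows "((\<lambda>t::real. f (z + c * of_real t)) has_vector_derivative f' c) (at 0)"
proof -
  interpret bounded_linear f' using assms by (rule has_derivative_bounded_linear)
  have "((\<lambda>t::real. z + c * of_real t) has_derivative (\<lambda>t. t *\<^sub>R c)) (at 0)"
    using has_derivative_add[OF has_derivative_const[of z]
        has_derivative_mult_right[OF has_derivative_of_real[OF has_derivative_ident], of c]]
    by (simp add: scaleR_conv_of_real mult.commute)
  moreover have "(f has_derivative f') (at (z + c * of_real 0))" using assms by simp
  ultimately have "((\<lambda>t::real. f (z + c * of_real t)) has_derivative (\<lambda>t. f' (t *\<^sub>R c))) (at 0)"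
    by (rule has_derivative_compose)
  then show ?thesis
    by (simp add: has_vector_derivative_def scaleR)
qed

lemma partial_x_eq: "(f has_derivative f') (at z) \<Longrightarrow> partial_x f z = f' 1"
  unfolding partial_x_def using has_vector_derivative_line[of f f' z 1]
  by (simp add: vector_derivative_at)

lemma partial_y_eq: "(f has_derivative f') (at z) \<Longrightarrow> partial_y f z = f' \<i>"
  unfolding partial_y_def using has_vector_derivative_line[of f f' z \<i>]
  by (simp add: vector_derivative_at)

lemma partial_wirt:
  assumes "has_wirt f A B z"
  shows "partial_x f z = A + B" "partial_y f z = \<i> * (A - B)" "d_z f z = A" "d_zbar f z = B"
    "partial_x (\<lambda>w. Re (f w)) z = Re (A + B)" "partial_y (\<lambda>w. Re (f w)) z = - Im (A - B)"
    "partial_x (\<lambda>w. Im (f w)) z = Im (A + B)" "partial_y (\<lambda>w. Im (f w)) z = Re (A - B)"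
proof -
  have d: "(f has_derivative (\<lambda>h. A * h + B * cnj h)) (at z)"
    using assms by (simp add: has_wirt_def)
  show 1: "partial_x f z = A + B" "partial_y f z = \<i> * (A - B)"
    using partial_x_eq[OF d] partial_y_eq[OF d] by (auto simp: algebra_simps)
  show "d_z f z = A" "d_zbar f z = B" unfolding d_z_def d_zbar_def 1 
    by (auto simp: algebra_simps)
  have re: "((\<lambda>w. Re (f w)) has_derivative (\<lambda>h. Re (A * h + B * cnj h))) (at z)"
    using d by (rule bounded_linear.has_derivative[OF bounded_linear_Re])
  have im: "((\<lambda>w. Im (f w)) has_derivative (\<lambda>h. Im (A * h + B * cnj h))) (at z)"
    using d by (rule bounded_linear.has_derivative[OF bounded_linear_Im])
  show "partial_x (\<lambda>w. Re (f w)) z = Re (A + B)" "partial_y (\<lambda>w. Re (f w)) z = - Im (A - B)"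
    "partial_x (\<lambda>w. Im (f w)) z = Im (A + B)" "partial_y (\<lambda>w. Im (f w)) z = Re (A - B)"
    using partial_x_eq[OF re] partial_y_eq[OF re] partial_x_eq[OF im] partial_y_eq[OF im] by auto
qed

lemma differentiable_has_wirt:
  assumes "f differentiable (at z)"
  shows "has_wirt f (d_z f z) (d_zbar f z) z"
proof -
  obtain f' where f': "(f has_derivative f') (at z)"
    using assms by (auto simp: differentiable_def)
  interpret bounded_linear f' using f' by (rule has_derivative_bounded_linear)
  have "f' h = d_z f z * h + d_zbar f z * cnj h" for h
  proof -
    have "f' h = f' (Re h *\<^sub>R 1 + Im h *\<^sub>R \<i>)" 
      by (rule arg_cong[of _ _ f']) (simp add: complex_eq_iff)
    also have "\<dots> = Re h *\<^sub>R f' 1 + Im h *\<^sub>R f' \<i>" by (simp only: add scaleR)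
    also have "\<dots> = d_z f z * h + d_zbar f z * cnj h"
      unfolding d_z_def d_zbar_def partial_x_eq[OF f'] partial_y_eq[OF f']
      by (simp add: complex_eq_iff field_simps)
    finally show ?thesis .
  qed
  then show ?thesis unfolding has_wirt_def by (intro has_derivative_eq_rhs[OF f']) auto
qed

lemma C1_on_wirtD:
  assumes "C1_on \<Omega> f"
  shows "z \<in> \<Omega> \<Longrightarrow> has_wirt f (d_z f z) (d_zbar f z) z"
    "continuous_on \<Omega> (d_z f)" "continuous_on \<Omega> (d_zbar f)" "continuous_on \<Omega> f"
proof -
  show "z \<in> \<Omega> \<Longrightarrow> has_wirt f (d_z f z) (d_zbar f z) z"
    using assms differentiable_has_wirt by (auto simp: C1_on_def)
  have "continuous_on \<Omega> (partial_x f)" "continuous_on \<Omega> (partial_y f)" 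
    using assms by (auto simp: C1_on_def)
  then show "continuous_on \<Omega> (d_z f)" "continuous_on \<Omega> (d_zbar f)"
    unfolding d_z_def[abs_def] d_zbar_def[abs_def] by (auto intro!: continuous_intros)
  show "continuous_on \<Omega> f"
    using assms by (auto simp: C1_on_def intro!: continuous_at_imp_continuous_on differentiable_imp_continuous_within)
qed

lemma C1_on_wirtI:
  assumes "\<And>z. z \<in> \<Omega> \<Longrightarrow> has_wirt f (A z) (B z) z" "continuous_on \<Omega> A" "continuous_on \<Omega> B"
  shows "C1_on \<Omega> f"
  unfolding C1_on_def
proof (intro conjI ballI)
  fix z assume "z \<in> \<Omega>"
  then show "f differentiable (at z)"
    using assms(1) by (auto simp: has_wirt_def differentiable_def)
next
  show "continuous_on \<Omega> (partial_x f)" "continuous_on \<Omega> (partial_y f)"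
    using assms(2,3)
    by (auto simp: partial_wirt(1,2)[OF assms(1)] intro!: continuous_intros cong: continuous_on_cong)
qed

section \<open>Line integrals of exact forms\<close>

text \<open>Dropping tags could only merge pieces with empty interior, and such a piece is a point
  and contributes 0. So the length bound, stated for plain divisions, also governs the tagged sums
  of the line integral.\<close>

lemma sum_tagged_division_dist_le:
  fixes \<gamma> :: "real \<Rightarrow> complex"
  assumes D: "D tagged_division_of {0..1}"
    and L: "\<And>D. D division_of {0..1} \<Longrightarrow> (\<Sum>K\<in>D. dist (\<gamma> (Inf K)) (\<gamma> (Sup K))) \<le> L"
  shows "(\<Sum>(t, K)\<in>D. dist (\<gamma> (Inf K)) (\<gamma> (Sup K))) \<le> L"
proof -
  \<comment> \<open>The library lemma wants the summand to vanish on every interval with empty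
    interior, the empty one included, where \<open>Inf\<close> and \<open>Sup\<close> carry no
    information.\<close>
  let ?d = "\<lambda>K. if K = {} then 0 else dist (\<gamma> (Inf K)) (\<gamma> (Sup K))"
  have ne: "K \<noteq> {}" if "(t, K) \<in> D" for t K
    using tagged_division_ofD(2)[OF D that] by auto
  have "(\<Sum>(t, K)\<in>D. dist (\<gamma> (Inf K)) (\<gamma> (Sup K))) = (\<Sum>(t, K)\<in>D. ?d K)"
    by (rule sum.cong) (auto dest: ne)
  also have "\<dots> = sum ?d (snd ` D)"
  proof (rule sum.over_tagged_division_lemma[OF D])
    fix u v :: real
    assume "box u v = {}"
    then have "v \<le> u" by (simp add: box_real)
    then show "?d (cbox u v) = 0"
      by (cases "u = v") auto
  qed
  also have "\<dots> = (\<Sum>K\<in>snd ` D. dist (\<gamma> (Inf K)) (\<gamma> (Sup K)))"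
    by (rule sum.cong) (auto dest: ne)
  also have "\<dots> \<le> L"
    by (rule L[OF division_of_tagged_division[OF D]])
  finally show ?thesis .
qed

text \<open>The expansion compares two points near \<open>z\<close> rather than \<open>z\<close>
  with one neighbour, since a tag need not be an endpoint of its interval. It is the mean value
  inequality for \<open>f\<close> minus its linear part frozen at \<open>z\<close>; uniform
  continuity of \<open>A\<close> and \<open>B\<close> on a slightly larger compact set makes the
  derivative of that difference small.\<close>

lemma has_wirt_uniform_on_compact:
  assumes "open \<Omega>" "compact C" "C \<subseteq> \<Omega>" "e > 0"
    and f: "\<And>z. z \<in> \<Omega> \<Longrightarrow> has_wirt f (A z) (B z) z"
    and cont: "continuous_on \<Omega> A" "continuous_on \<Omega> B"
  obtains d where "d > 0" and "\<And>z x y. z \<in> C \<Longrightarrow> dist x z < d \<Longrightarrow> dist y z < d \<Longrightarrow>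
      cmod (f y - f x - (A z * (y - x) + B z * cnj (y - x))) \<le> e * dist x y"
proof -
  obtain r where r: "r > 0" "(\<Union>z\<in>C. cball z r) \<subseteq> \<Omega>"
    using compact_subset_open_imp_cball_epsilon_subset[OF assms(2,1,3)] by blast
  define C' where "C' = (\<Union>z\<in>C. cball z r)"
  have C'eq: "C' = {x + y |x y. x \<in> C \<and> y \<in> cball 0 r}"
  proof (intro set_eqI iffI)
    fix w assume "w \<in> C'"
    then obtain z where "z \<in> C" "dist z w \<le> r" by (auto simp: C'_def)
    then show "w \<in> {x + y |x y. x \<in> C \<and> y \<in> cball 0 r}"
      by (intro CollectI exI[of _ z] exI[of _ "w - z"]) (auto simp: dist_norm norm_minus_commute)
  next
    fix w assume "w \<in> {x + y |x y. x \<in> C \<and> y \<in> cball 0 r}"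
    then obtain z y where "w = z + y" "z \<in> C" "y \<in> cball 0 r" by blast
    then show "w \<in> C'"
      unfolding C'_def by (intro UN_I[of z]) (auto simp: dist_norm)
  qed
  have "compact C'" unfolding C'eq by (rule compact_sums[OF assms(2) compact_cball])
  have C'sub: "C' \<subseteq> \<Omega>" using r(2) by (auto simp: C'_def)
  have "uniformly_continuous_on C' A" "uniformly_continuous_on C' B"
    using cont C'sub \<open>compact C'\<close> compact_uniformly_continuous continuous_on_subset by blast+
  then obtain d1 d2 where d: "d1 > 0" "d2 > 0"
      "\<And>x y. x \<in> C' \<Longrightarrow> y \<in> C' \<Longrightarrow> dist x y < d1 \<Longrightarrow> dist (A x) (A y) < e / 2"
      "\<And>x y. x \<in> C' \<Longrightarrow> y \<in> C' \<Longrightarrow> dist x y < d2 \<Longrightarrow> dist (B x) (B y) < e / 2"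
    unfolding uniformly_continuous_on_def using \<open>e > 0\<close> by (metis half_gt_zero)
  define d where "d = min r (min d1 d2)"
  show thesis
  proof
    show "d > 0" using d r by (auto simp: d_def)
    fix z x y assume z: "z \<in> C" "dist x z < d" "dist y z < d"
    let ?g = "\<lambda>w. f w - (A z * w + B z * cnj w)"
    have sub: "ball z d \<subseteq> C'" using z(1) unfolding C'_def d_def by force
    have zC: "z \<in> C'" using z(1) r(1) by (force simp: C'_def)
    have "cmod (?g y - ?g x) \<le> e * cmod (y - x)"
    proof (rule has_wirt_norm_le[OF convex_ball[of z d]])
      fix w assume w: "w \<in> ball z d"
      then have "w \<in> \<Omega>" using sub C'sub by auto
      from has_wirt_diff[OF f[OF this] has_wirt_add[OF has_wirt_cmult[OF has_wirt_ident]
            has_wirt_cmult[OF has_wirt_cnj[OF has_wirt_ident]]], of "A z" "B z"]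
      show "has_wirt ?g (A w - A z) (B w - B z) w" by simp
      have "cmod (A w - A z) < e / 2" "cmod (B w - B z) < e / 2"
        using d(3)[of w z] d(4)[of w z] subsetD[OF sub w] w zC
        by (auto simp: d_def dist_norm norm_minus_commute)
      then show "cmod (A w - A z) + cmod (B w - B z) \<le> e" by simp
    qed (use z in \<open>auto simp: dist_commute\<close>)
    then show "cmod (f y - f x - (A z * (y - x) + B z * cnj (y - x))) \<le> e * dist x y"
      by (simp add: dist_norm norm_minus_commute[of x y] algebra_simps)
  qed
qed

lemma has_line_integral_potential:
  assumes "open \<Omega>" "rectifiable_curve \<gamma>" "path_image \<gamma> \<subseteq> \<Omega>"
    and a: "\<And>z. z \<in> \<Omega> \<Longrightarrow> has_wirt (\<lambda>w. complex_of_real (a w)) (\<Phi> z) (cnj (\<Phi> z)) z"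
    and cont: "continuous_on \<Omega> \<Phi>"
  shows "has_line_integral (\<lambda>w. Re (\<Phi> w)) (\<lambda>w. - Im (\<Phi> w)) \<gamma> ((a (pathfinish \<gamma>) - a (pathstart \<gamma>)) / 2)"
  unfolding has_line_integral_def
proof (intro allI impI)
  fix e :: real assume "e > 0"
  obtain L where L: "\<And>D. D division_of {0..1} \<Longrightarrow> (\<Sum>K\<in>D. dist (\<gamma> (Inf K)) (\<gamma> (Sup K))) \<le> L"
    and path: "path \<gamma>"
    using assms(2) unfolding rectifiable_curve_def by blast
  define e' where "e' = e / (\<bar>L\<bar> + 1)"
  have e': "e' > 0" "e' * L < 2 * e"
  proof -
    show "e' > 0" using \<open>e > 0\<close> by (simp add: e'_def)
    have "e' * L \<le> e' * \<bar>L\<bar>" using \<open>e' > 0\<close> by (simp add: mult_left_mono)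
    also have "\<dots> \<le> e" using \<open>e > 0\<close> by (simp add: e'_def field_simps)
    finally show "e' * L < 2 * e" using \<open>e > 0\<close> by simp
  qed
  have contc: "continuous_on \<Omega> (\<lambda>z. cnj (\<Phi> z))" using cont by (intro continuous_intros)
  obtain d where d: "d > 0" "\<And>z x y. z \<in> path_image \<gamma> \<Longrightarrow> dist x z < d \<Longrightarrow> dist y z < d \<Longrightarrow>
      cmod (complex_of_real (a y) - complex_of_real (a x) - (\<Phi> z * (y - x) + cnj (\<Phi> z) * cnj (y - x))) \<le> e' * dist x y"
    using has_wirt_uniform_on_compact[OF assms(1) compact_path_image[OF path] assms(3) e'(1) a cont contc] by blast
  have "uniformly_continuous_on {0..1} \<gamma>"
    using path unfolding path_def by (simp add: compact_uniformly_continuous)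
  then obtain \<delta> where \<delta>: "\<delta> > 0" "\<And>s t. s \<in> {0..1} \<Longrightarrow> t \<in> {0..1} \<Longrightarrow> dist s t < \<delta> \<Longrightarrow> dist (\<gamma> s) (\<gamma> t) < d"
    unfolding uniformly_continuous_on_def using \<open>d > 0\<close> by metis
  show "\<exists>\<delta>>0. \<forall>D. D tagged_division_of {0..1} \<and> (\<lambda>t. ball t \<delta>) fine D \<longrightarrow>
        \<bar>(\<Sum>(t, K)\<in>D. Re (\<Phi> (\<gamma> t)) * (Re (\<gamma> (Sup K)) - Re (\<gamma> (Inf K)))
                    + - Im (\<Phi> (\<gamma> t)) * (Im (\<gamma> (Sup K)) - Im (\<gamma> (Inf K)))) -
            (a (pathfinish \<gamma>) - a (pathstart \<gamma>)) / 2\<bar> < e"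
  proof (intro exI[of _ \<delta>] conjI allI impI \<delta>(1), elim conjE)
    fix D assume D: "D tagged_division_of {0..1::real}" and fine: "(\<lambda>t. ball t \<delta>) fine D"
    let ?S = "\<lambda>(t, K). Re (\<Phi> (\<gamma> t)) * (Re (\<gamma> (Sup K)) - Re (\<gamma> (Inf K)))
                    + - Im (\<Phi> (\<gamma> t)) * (Im (\<gamma> (Sup K)) - Im (\<gamma> (Inf K)))"
    let ?T = "\<lambda>(t, K). a (\<gamma> (Sup K)) - a (\<gamma> (Inf K))"
    have part: "\<bar>2 * ?S (t, K) - ?T (t, K)\<bar> \<le> e' * dist (\<gamma> (Inf K)) (\<gamma> (Sup K))" if tK: "(t, K) \<in> D" for t K
    proof -
      obtain l u where K: "K = {l..u}" "t \<in> {l..u}" "{l..u} \<subseteq> {0..1}"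
        using tagged_division_ofD(2-4)[OF D tK] by (metis cbox_interval)
      have lu: "l \<le> u" "l \<in> {0..1}" "u \<in> {0..1}" "t \<in> {0..1}" using K(2,3) by auto
      have "{l..u} \<subseteq> ball t \<delta>" using fine tK K(1) by (auto simp: fine_def)
      then have "dist l t < \<delta>" "dist u t < \<delta>" using lu(1) by (auto simp: dist_commute subset_iff)
      then have near: "dist (\<gamma> l) (\<gamma> t) < d" "dist (\<gamma> u) (\<gamma> t) < d" using \<delta>(2) lu by auto
      have si: "Sup K = u" "Inf K = l" using K(1) lu by auto
      have "\<gamma> t \<in> path_image \<gamma>" using lu by (auto simp: path_image_def)
      from d(2)[OF this near]
      have b: "cmod (complex_of_real (a (\<gamma> u)) - complex_of_real (a (\<gamma> l)) - (\<Phi> (\<gamma> t) * (\<gamma> u - \<gamma> l) + cnj (\<Phi> (\<gamma> t)) * cnj (\<gamma> u - \<gamma> l))) 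
          \<le> e' * dist (\<gamma> l) (\<gamma> u)" .
      have "complex_of_real (a (\<gamma> u)) - complex_of_real (a (\<gamma> l)) - (\<Phi> (\<gamma> t) * (\<gamma> u - \<gamma> l) + cnj (\<Phi> (\<gamma> t)) * cnj (\<gamma> u - \<gamma> l))
         = complex_of_real (?T (t, K) - 2 * ?S (t, K))"
        by (simp add: si complex_eq_iff algebra_simps)
      then have "\<bar>?T (t, K) - 2 * ?S (t, K)\<bar> \<le> e' * dist (\<gamma> l) (\<gamma> u)"
        using b by (simp only: norm_of_real)
      then show ?thesis by (simp only: si abs_minus_commute[of "2 * _"])
    qed
    have "(\<Sum>x\<in>D. ?T x) = a (\<gamma> 1) - a (\<gamma> 0)"
      using additive_tagged_division_1[OF _ D, of "\<lambda>t. a (\<gamma> t)"] by simp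
    then have "\<bar>2 * (\<Sum>x\<in>D. ?S x) - (a (pathfinish \<gamma>) - a (pathstart \<gamma>))\<bar> = \<bar>\<Sum>x\<in>D. (2 * ?S x - ?T x)\<bar>"
      by (simp add: sum_subtractf sum_distrib_left pathfinish_def pathstart_def)
    also have "\<dots> \<le> (\<Sum>x\<in>D. \<bar>2 * ?S x - ?T x\<bar>)" by (rule sum_abs)
    also have "\<dots> \<le> (\<Sum>x\<in>D. e' * (case x of (t, K) \<Rightarrow> dist (\<gamma> (Inf K)) (\<gamma> (Sup K))))"
      using part by (intro sum_mono) auto
    also have "\<dots> = e' * (\<Sum>(t, K)\<in>D. dist (\<gamma> (Inf K)) (\<gamma> (Sup K)))" by (simp add: sum_distrib_left)
    also have "\<dots> \<le> e' * L"
      using sum_tagged_division_dist_le[OF D L] e'(1) by (intro mult_left_mono) auto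
    also have "\<dots> < 2 * e" by (rule e'(2))
    finally have "\<bar>2 * (\<Sum>x\<in>D. ?S x) - (a (pathfinish \<gamma>) - a (pathstart \<gamma>))\<bar> < 2 * e" .
    moreover have "\<bar>2 * x - y\<bar> < 2 * e \<Longrightarrow> \<bar>x - y / 2\<bar> < e" for x y by linarith
    ultimately show "\<bar>(\<Sum>x\<in>D. ?S x) - (a (pathfinish \<gamma>) - a (pathstart \<gamma>)) / 2\<bar> < e" by blast
  qed
qed

text \<open>In Wirtinger terms the compatibility condition reads
  \<open>2 * Im (d_zbar \<Phi> z) = 0\<close>. Any base point serves, the constant being the value
  of \<open>a\<close> there.\<close>

lemma is_A_potential:
  assumes "open \<Omega>" "\<Omega> \<noteq> {}" and C1: "C1_on \<Omega> \<Phi>"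
    and a: "\<And>z. z \<in> \<Omega> \<Longrightarrow> has_wirt (\<lambda>w. complex_of_real (a w)) (\<Phi> z) (cnj (\<Phi> z)) z"
    and cl: "\<And>z. z \<in> \<Omega> \<Longrightarrow> Im (d_zbar \<Phi> z) = 0"
  shows "is_A \<Omega> \<Phi> a"
  unfolding is_A_def
proof (intro conjI C1 ballI)
  fix z assume "z \<in> \<Omega>"
  then show "partial_y (\<lambda>w. Re (\<Phi> w)) z + partial_x (\<lambda>w. Im (\<Phi> w)) z = 0"
    using partial_wirt(6,7)[OF C1_on_wirtD(1)[OF C1]] cl by simp
next
  obtain z0 where "z0 \<in> \<Omega>" using \<open>\<Omega> \<noteq> {}\<close> by auto
  have "\<exists>I. has_line_integral (\<lambda>w. Re (\<Phi> w)) (\<lambda>w. - Im (\<Phi> w)) \<Gamma> I \<and> a (pathfinish \<Gamma>) = 2 * I + a (pathstart \<Gamma>)"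
    if "rectifiable_curve \<Gamma>" "path_image \<Gamma> \<subseteq> \<Omega>" for \<Gamma>
    using has_line_integral_potential[OF \<open>open \<Omega>\<close> that a C1_on_wirtD(4)[OF C1]]
    by (intro exI[of _ "(a (pathfinish \<Gamma>) - a (pathstart \<Gamma>)) / 2"]) (auto simp: field_simps)
  with \<open>z0 \<in> \<Omega>\<close> show "\<exists>z0\<in>\<Omega>. \<exists>c. \<forall>z\<in>\<Omega>. \<forall>\<Gamma>. rectifiable_curve \<Gamma> \<and> path_image \<Gamma> \<subseteq> \<Omega> \<and>
        pathstart \<Gamma> = z0 \<and> pathfinish \<Gamma> = z \<longrightarrow>
        (\<exists>I. has_line_integral (\<lambda>w. Re (\<Phi> w)) (\<lambda>w. - Im (\<Phi> w)) \<Gamma> I \<and> a z = 2 * I + c)"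
    by (intro bexI[of _ z0] exI[of _ "a z0"]) auto
qed

text \<open>This is the operator \<open>A\<close> for \<open>cnj \<Phi>\<close>; the condition turns
  into \<open>- 2 * Im (d_z \<Phi> z) = 0\<close>.\<close>

lemma is_A_bar_potential:
  assumes "open \<Omega>" "\<Omega> \<noteq> {}" and C1: "C1_on \<Omega> \<Phi>"
    and a: "\<And>z. z \<in> \<Omega> \<Longrightarrow> has_wirt (\<lambda>w. complex_of_real (a w)) (cnj (\<Phi> z)) (\<Phi> z) z"
    and cl: "\<And>z. z \<in> \<Omega> \<Longrightarrow> Im (d_z \<Phi> z) = 0"
  shows "is_A_bar \<Omega> \<Phi> a"
  unfolding is_A_bar_def
proof (intro conjI C1 ballI)
  fix z assume "z \<in> \<Omega>"
  then show "partial_y (\<lambda>w. Re (\<Phi> w)) z - partial_x (\<lambda>w. Im (\<Phi> w)) z = 0"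
    using partial_wirt(6,7)[OF C1_on_wirtD(1)[OF C1]] cl by simp
next
  obtain z0 where "z0 \<in> \<Omega>" using \<open>\<Omega> \<noteq> {}\<close> by auto
  have cc: "continuous_on \<Omega> (\<lambda>z. cnj (\<Phi> z))"
    using C1_on_wirtD(4)[OF C1] by (intro continuous_intros)
  have "\<exists>I. has_line_integral (\<lambda>w. Re (\<Phi> w)) (\<lambda>w. Im (\<Phi> w)) \<Gamma> I \<and> a (pathfinish \<Gamma>) = 2 * I + a (pathstart \<Gamma>)"
    if "rectifiable_curve \<Gamma>" "path_image \<Gamma> \<subseteq> \<Omega>" for \<Gamma>
    using has_line_integral_potential[OF \<open>open \<Omega>\<close> that _ cc, of a] a
    by (intro exI[of _ "(a (pathfinish \<Gamma>) - a (pathstart \<Gamma>)) / 2"]) (auto simp: field_simps)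
  with \<open>z0 \<in> \<Omega>\<close> show "\<exists>z0\<in>\<Omega>. \<exists>c. \<forall>z\<in>\<Omega>. \<forall>\<Gamma>. rectifiable_curve \<Gamma> \<and> path_image \<Gamma> \<subseteq> \<Omega> \<and>
        pathstart \<Gamma> = z0 \<and> pathfinish \<Gamma> = z \<longrightarrow>
        (\<exists>I. has_line_integral (\<lambda>w. Re (\<Phi> w)) (\<lambda>w. Im (\<Phi> w)) \<Gamma> I \<and> a z = 2 * I + c)"
    by (intro bexI[of _ z0] exI[of _ "a z0"]) auto
qed

section \<open>Poincare lemma\<close>

text \<open>The derivative as a bounded linear operator: differentiation under the integral sign
  requires a derivative depending continuously on the parameter in operator norm.\<close>

definition wirt_blinfun :: "complex \<Rightarrow> complex \<Rightarrow> complex \<Rightarrow>\<^sub>L complex" where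
  "wirt_blinfun A B = blinfun_mult_right A + (blinfun_mult_right B o\<^sub>L Blinfun cnj)"

lemma wirt_blinfun_apply: "blinfun_apply (wirt_blinfun A B) h = A * h + B * cnj h"
  by (simp add: wirt_blinfun_def blinfun.add_left blinfun_mult_right.rep_eq
      bounded_linear_Blinfun_apply bounded_linear_cnj)

lemma continuous_on_wirt_blinfun:
  assumes "continuous_on S A" "continuous_on S B"
  shows "continuous_on S (\<lambda>x. wirt_blinfun (A x) (B x))"
  unfolding wirt_blinfun_def
  by (intro continuous_on_add bounded_bilinear.continuous_on[OF bounded_bilinear_blinfun_compose]
      bounded_linear.continuous_on[OF bounded_linear_blinfun_mult_right] continuous_on_const assms)

lemma has_wirt_line:
  assumes "has_wirt f A B (a + of_real t * w)"
  shows "((\<lambda>t::real. f (a + of_real t * w)) has_vector_derivative A * w + B * cnj w) (at t)"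
proof -
  have "((\<lambda>t::real. a + of_real t * w) has_derivative (\<lambda>h. of_real h * w)) (at t)"
    using has_derivative_add[OF has_derivative_const[of a]
        has_derivative_mult_left[OF has_derivative_of_real[OF has_derivative_ident], of w]]
    by simp
  from has_derivative_compose[OF this assms[unfolded has_wirt_def]]
  show ?thesis
    by (simp add: has_vector_derivative_def scaleR_conv_of_real algebra_simps)
qed

text \<open>The primitive of \<open>\<alpha> dz + \<beta> d(cnj z)\<close> is its integral along the
  segment from a fixed point. Coefficients are arbitrary complex functions, as the regularity
  argument integrates a form that is not real; the last conclusion recovers real primitives of real
  forms.\<close>

lemma poincare_convex:
  assumes U: "open U" "convex U"
    and \<alpha>: "\<And>z. z \<in> U \<Longrightarrow> has_wirt \<alpha> (\<alpha>1 z) (\<alpha>2 z) z"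
    and \<beta>: "\<And>z. z \<in> U \<Longrightarrow> has_wirt \<beta> (\<beta>1 z) (\<beta>2 z) z"
    and cont: "continuous_on U \<alpha>1" "continuous_on U \<alpha>2" "continuous_on U \<beta>1" "continuous_on U \<beta>2"
    and closed: "\<And>z. z \<in> U \<Longrightarrow> \<alpha>2 z = \<beta>1 z"
  obtains N where "\<And>z. z \<in> U \<Longrightarrow> has_wirt N (\<alpha> z) (\<beta> z) z"
    and "(\<And>z. z \<in> U \<Longrightarrow> \<beta> z = cnj (\<alpha> z)) \<Longrightarrow> (\<And>z. z \<in> U \<Longrightarrow> N z \<in> \<real>)"
proof (cases "U = {}")
  case True
  then show ?thesis using that by auto
next
  case False
  then obtain a where a: "a \<in> U" by auto
  define p where "p z t = a + of_real t * (z - a)" for z and t :: real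
  define f where "f z t = \<alpha> (p z t) * (z - a) + \<beta> (p z t) * cnj (z - a)" for z t
  \<comment> \<open>Differentiating \<open>f\<close> in \<open>z\<close> produces
    \<open>\<beta>1\<close> here; closedness replaces it by \<open>\<alpha>2\<close>. In this form
    \<open>A z t\<close> is the \<open>t\<close>-derivative of
    \<open>of_real t * \<alpha> (p z t)\<close>, likewise \<open>B\<close>, so the integral over
    \<open>t\<close> is evaluated by its endpoints.\<close>
  define A where "A z t = \<alpha> (p z t) + of_real t * (\<alpha>1 (p z t) * (z - a) + \<alpha>2 (p z t) * cnj (z - a))" for z t
  define B where "B z t = \<beta> (p z t) + of_real t * (\<beta>1 (p z t) * (z - a) + \<beta>2 (p z t) * cnj (z - a))" for z t
  define N where "N z = integral (cbox 0 1) (f z)" for z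
  have pU: "p z t \<in> U" if "z \<in> U" "t \<in> {0..1}" for z t
  proof -
    have "p z t = (1 - t) *\<^sub>R a + t *\<^sub>R z" by (simp add: p_def scaleR_conv_of_real algebra_simps)
    then show ?thesis using convexD_alt[OF U(2) a that(1), of t] that(2) by simp
  qed
  have cp: "continuous_on (U \<times> cbox 0 1) (\<lambda>(z, t). p z t)"
    unfolding p_def case_prod_beta by (intro continuous_intros)
  have comp: "continuous_on (U \<times> cbox 0 1) (\<lambda>(z, t). g (p z t))" if "continuous_on U g" for g :: "complex \<Rightarrow> complex"
    unfolding case_prod_beta by (rule continuous_on_compose2[OF that cp[unfolded case_prod_beta]]) (use pU in auto)
  have c: "continuous_on U \<alpha>" "continuous_on U \<beta>"
    using \<alpha> \<beta> continuous_on_has_wirt by blast+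
  note cc = comp[OF c(1), unfolded case_prod_beta] comp[OF c(2), unfolded case_prod_beta]
    comp[OF cont(1), unfolded case_prod_beta] comp[OF cont(2), unfolded case_prod_beta]
    comp[OF cont(3), unfolded case_prod_beta] comp[OF cont(4), unfolded case_prod_beta]
  have AB: "continuous_on (U \<times> cbox 0 1) (\<lambda>(z, t). A z t)" "continuous_on (U \<times> cbox 0 1) (\<lambda>(z, t). B z t)"
    unfolding A_def B_def case_prod_beta by (intro continuous_intros cc)+
  have fc: "continuous_on (U \<times> cbox 0 1) (\<lambda>(z, t). f z t)"
    unfolding f_def case_prod_beta by (intro continuous_intros cc)+
  have slice: "continuous_on (cbox 0 1) (g z)" if "continuous_on (U \<times> cbox 0 1) (\<lambda>(z, t). g z t)" "z \<in> U" 
    for g :: "complex \<Rightarrow> real \<Rightarrow> complex" and z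
    using continuous_on_compose2[OF that(1) continuous_on_Pair[OF continuous_on_const[of _ z] continuous_on_id],
        of "cbox 0 1"] that(2) by auto
  have fw: "has_wirt (\<lambda>z. f z t) (A z t) (B z t) z" if z: "z \<in> U" and t: "t \<in> cbox 0 1" for z t
  proof -
    have P: "((\<lambda>z. p z t) has_field_derivative of_real t) (at z)"
      unfolding p_def by (auto intro!: derivative_eq_intros)
    have "t \<in> {0..1}" using t by simp
    note pt = pU[OF z this]
    note w = has_wirt_diff[OF has_wirt_ident has_wirt_const, of a z]
    show ?thesis unfolding f_def
      by (rule has_wirt_eq[OF has_wirt_add[OF 
             has_wirt_mult[OF has_wirt_comp_field[OF \<alpha>[OF pt] P] w]
             has_wirt_mult[OF has_wirt_comp_field[OF \<beta>[OF pt] P] has_wirt_cnj[OF w]]]])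
         (simp_all add: A_def B_def closed[OF pt] algebra_simps)
  qed
  have main: "has_wirt N (\<alpha> z) (\<beta> z) z" if z: "z \<in> U" for z
  proof -
    have D: "((\<lambda>z. integral (cbox 0 1) (f z)) has_derivative integral (cbox 0 1) (\<lambda>t. wirt_blinfun (A z t) (B z t))) (at z within U)"
    proof (rule leibniz_rule[OF _ _ _ z U(2)])
      show "((\<lambda>z. f z t) has_derivative blinfun_apply (wirt_blinfun (A z t) (B z t))) (at z within U)"
        if "z \<in> U" "t \<in> cbox 0 1" for z t
        using fw[OF that] unfolding has_wirt_def wirt_blinfun_apply[abs_def]
        by (rule has_derivative_at_withinI)
      show "f z integrable_on cbox 0 1" if "z \<in> U" for z
        using slice[OF fc that] by (rule integrable_continuous)
      show "continuous_on (U \<times> cbox 0 1) (\<lambda>(z, t). wirt_blinfun (A z t) (B z t))"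
        using continuous_on_wirt_blinfun[OF AB[unfolded case_prod_beta]] by (simp add: case_prod_beta)
    qed
    have "blinfun_apply (integral (cbox 0 1) (\<lambda>t. wirt_blinfun (A z t) (B z t))) h = \<alpha> z * h + \<beta> z * cnj h" for h
    proof -
      have "continuous_on (cbox 0 1) (\<lambda>t. wirt_blinfun (A z t) (B z t))"
        by (intro continuous_on_wirt_blinfun slice[OF AB(1) z] slice[OF AB(2) z])
      note eq = blinfun_apply_integral[OF integrable_continuous[OF this], of h, unfolded wirt_blinfun_apply]
      define F where "F t = of_real t * (\<alpha> (p z t) * h + \<beta> (p z t) * cnj h)" for t :: real
      have "((\<lambda>t. A z t * h + B z t * cnj h) has_integral F 1 - F 0) {0..1}"
      proof (rule fundamental_theorem_of_calculus[of 0 1 F])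
        fix t :: real assume t: "t \<in> {0..1}"
        have 1: "((\<lambda>t. \<alpha> (p z t)) has_vector_derivative \<alpha>1 (p z t) * (z - a) + \<alpha>2 (p z t) * cnj (z - a)) (at t within {0..1})"
          unfolding p_def by (rule has_vector_derivative_at_within[OF has_wirt_line[OF \<alpha>[OF pU[OF z t, unfolded p_def]]]])
        have 2: "((\<lambda>t. \<beta> (p z t)) has_vector_derivative \<beta>1 (p z t) * (z - a) + \<beta>2 (p z t) * cnj (z - a)) (at t within {0..1})"
          unfolding p_def by (rule has_vector_derivative_at_within[OF has_wirt_line[OF \<beta>[OF pU[OF z t, unfolded p_def]]]])
        have 3: "((\<lambda>t::real. complex_of_real t) has_vector_derivative 1) (at t within {0..1})"
          using has_vector_derivative_of_real[OF DERIV_ident] by simp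
        show "(F has_vector_derivative A z t * h + B z t * cnj h) (at t within {0..1})"
          unfolding F_def
          by (rule has_vector_derivative_eq_rhs[OF has_vector_derivative_mult[OF 3
                 has_vector_derivative_add[OF has_vector_derivative_mult_left[OF 1] has_vector_derivative_mult_left[OF 2]]]])
             (simp add: A_def B_def algebra_simps)
      qed simp
      then have "integral (cbox 0 1) (\<lambda>t. A z t * h + B z t * cnj h) = \<alpha> z * h + \<beta> z * cnj h"
        using integral_unique by (simp add: F_def p_def)
      with eq show ?thesis by (simp only:)
    qed
    then have "integral (cbox 0 1) (\<lambda>t. wirt_blinfun (A z t) (B z t)) = wirt_blinfun (\<alpha> z) (\<beta> z)"
      by (intro blinfun_eqI) (simp add: wirt_blinfun_apply)
    moreover have "N = (\<lambda>z. integral (cbox 0 1) (f z))" by (rule ext) (rule N_def)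
    ultimately have "(N has_derivative blinfun_apply (wirt_blinfun (\<alpha> z) (\<beta> z))) (at z)"
      using D by (simp only: at_within_open[OF z U(1)])
    then show ?thesis
      unfolding has_wirt_def by (rule has_derivative_eq_rhs) (rule ext, rule wirt_blinfun_apply)
  qed
  show ?thesis
  proof (rule that[OF main])
    fix z assume r: "\<And>z. z \<in> U \<Longrightarrow> \<beta> z = cnj (\<alpha> z)" and z: "z \<in> U"
    have "cnj (f z t) = f z t" if "t \<in> cbox 0 1" for t
      using r[OF pU[OF z, of t]] that by (simp add: f_def)
    then have "integral (cbox 0 1) (\<lambda>t. cnj (f z t)) = N z" 
      unfolding N_def by (intro integral_cong)
    moreover have "integral (cbox 0 1) (\<lambda>t. cnj (f z t)) = cnj (N z)"
      unfolding N_def using integral_linear[OF integrable_continuous[OF slice[OF fc z]] bounded_linear_cnj]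
      by (simp add: o_def)
    ultimately show "N z \<in> \<real>" by (simp add: Reals_cnj_iff)
  qed
qed

text \<open>The plane is convex. Otherwise the form is pulled back by the inverse Riemann map
  \<open>g\<close>: its coefficient becomes \<open>\<Phi> (g w) * deriv g w\<close>, whose
  \<open>d_zbar\<close> is \<open>d_zbar \<Phi> (g w)\<close> times the squared modulus of
  \<open>deriv g w\<close>, hence still real. A potential on the disc composed with \<open>f\<close>
  is a potential on \<open>\<Omega>\<close>, as the derivatives of \<open>f\<close> and
  \<open>g\<close> are reciprocal. No gluing of local primitives occurs.\<close>

lemma poincare_simply_connected:
  assumes \<Omega>: "open \<Omega>" "simply_connected \<Omega>"
    and C1: "C1_on \<Omega> \<Phi>"
    and cl: "\<And>z. z \<in> \<Omega> \<Longrightarrow> Im (d_zbar \<Phi> z) = 0"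
  obtains a where "\<And>z. z \<in> \<Omega> \<Longrightarrow> has_wirt (\<lambda>w. complex_of_real (a w)) (\<Phi> z) (cnj (\<Phi> z)) z"
proof -
  have convex_case: thesis' if U: "open U" "convex U" and C1: "C1_on U \<Psi>" 
     and cl: "\<And>z. z \<in> U \<Longrightarrow> Im (d_zbar \<Psi> z) = 0"
     and *: "\<And>b. (\<And>z. z \<in> U \<Longrightarrow> has_wirt (\<lambda>w. complex_of_real (b w)) (\<Psi> z) (cnj (\<Psi> z)) z) \<Longrightarrow> thesis'"
   for U \<Psi> thesis'
  proof -
    have cn: "continuous_on U (\<lambda>z. cnj (d_z \<Psi> z))" "continuous_on U (\<lambda>z. cnj (d_zbar \<Psi> z))"
      using C1_on_wirtD(2,3)[OF C1] by (auto intro: continuous_intros)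
    obtain N where N: "\<And>z. z \<in> U \<Longrightarrow> has_wirt N (\<Psi> z) (cnj (\<Psi> z)) z" "\<And>z. z \<in> U \<Longrightarrow> N z \<in> \<real>"
      using poincare_convex[OF U C1_on_wirtD(1)[OF C1] has_wirt_cnj[OF C1_on_wirtD(1)[OF C1]]
        C1_on_wirtD(2,3)[OF C1] cn(2,1)] cl by (auto simp: complex_eq_iff)
    show ?thesis
    proof (rule *)
      fix z assume "z \<in> U"
      then show "has_wirt (\<lambda>w. complex_of_real (Re (N w))) (\<Psi> z) (cnj (\<Psi> z)) z"
        by (intro has_wirt_cong[OF N(1) U(1)]) (auto simp: N(2))
    qed
  qed
  consider "\<Omega> = {}" | "\<Omega> = UNIV" | f g where "f holomorphic_on \<Omega>" "g holomorphic_on ball 0 1"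
      "\<And>z. z \<in> \<Omega> \<Longrightarrow> f z \<in> ball 0 1 \<and> g (f z) = z" "\<And>z. z \<in> ball 0 1 \<Longrightarrow> g z \<in> \<Omega> \<and> f (g z) = z"
    using \<Omega> simply_connected_eq_biholomorphic_to_disc by metis
  then show ?thesis
  proof cases
    case 1 then show ?thesis using that by auto
  next
    case 2 then show ?thesis using convex_case[OF \<Omega>(1) _ C1 cl] that by auto
  next
    case 3
    let ?U = "ball (0::complex) 1"
    let ?\<Psi> = "\<lambda>w. \<Phi> (g w) * deriv g w"
    have g': "(g has_field_derivative deriv g w) (at w)" "(deriv g has_field_derivative deriv (deriv g) w) (at w)"
      if "w \<in> ?U" for w
      using 3(2) that by (auto intro!: holomorphic_derivI[of _ ?U] holomorphic_deriv)
    have \<Psi>: "has_wirt ?\<Psi> (d_z \<Phi> (g w) * deriv g w * deriv g w + \<Phi> (g w) * deriv (deriv g) w)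
        (d_zbar \<Phi> (g w) * cnj (deriv g w) * deriv g w) w" if "w \<in> ?U" for w
      using has_wirt_mult[OF has_wirt_comp_field[OF C1_on_wirtD(1)[OF C1] g'(1)[OF that]] has_wirt_of_field[OF g'(2)[OF that]]]
        3(4)[OF that] by simp
    have cg: "continuous_on ?U g" "continuous_on ?U (deriv g)" "continuous_on ?U (deriv (deriv g))"
      using 3(2) by (auto intro!: holomorphic_on_imp_continuous_on holomorphic_deriv)
    have cc: "continuous_on ?U (\<lambda>w. h (g w))" if "continuous_on \<Omega> h" for h :: "complex \<Rightarrow> complex"
      using 3(4) by (intro continuous_on_compose2[OF that cg(1)]) auto
    have "C1_on ?U ?\<Psi>"
      by (rule C1_on_wirtI[OF \<Psi>]) (auto intro!: continuous_intros cg cc C1_on_wirtD(2-4)[OF C1])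
    moreover have "Im (d_zbar ?\<Psi> w) = 0" if "w \<in> ?U" for w
    proof -
      have "d_zbar ?\<Psi> w = d_zbar \<Phi> (g w) * (deriv g w * cnj (deriv g w))"
        using partial_wirt(4)[OF \<Psi>[OF that]] by simp
      also have "\<dots> = d_zbar \<Phi> (g w) * complex_of_real ((cmod (deriv g w))\<^sup>2)"
        by (simp only: complex_norm_square)
      finally show ?thesis using cl[of "g w"] 3(4)[OF that] by simp
    qed
    ultimately obtain b where b: "\<And>w. w \<in> ?U \<Longrightarrow> has_wirt (\<lambda>w. complex_of_real (b w)) (?\<Psi> w) (cnj (?\<Psi> w)) w"
      using convex_case[of ?U ?\<Psi>] by auto
    show ?thesis
    proof (rule that[of "\<lambda>z. b (f z)"])
      fix z assume z: "z \<in> \<Omega>"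
      have f': "(f has_field_derivative deriv f z) (at z)"
        using 3(1) z \<Omega>(1) by (auto intro!: holomorphic_derivI)
      have fz: "f z \<in> ?U" using 3(3) z by blast
      have "((\<lambda>w. g (f w)) has_field_derivative deriv g (f z) * deriv f z) (at z)"
        by (rule DERIV_chain2[OF g'(1)[OF fz] f'])
      moreover have "((\<lambda>w. g (f w)) has_field_derivative 1) (at z)"
        by (rule has_field_derivative_transform_within_open[OF DERIV_ident \<Omega>(1) z]) (use 3(3) in auto)
      ultimately have one: "deriv g (f z) * deriv f z = 1" by (rule DERIV_unique)
      have "has_wirt (\<lambda>w. complex_of_real (b (f w))) (?\<Psi> (f z) * deriv f z) (cnj (?\<Psi> (f z)) * cnj (deriv f z)) z"
        by (rule has_wirt_comp_field[OF b[OF fz] f'])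
      moreover have e: "?\<Psi> (f z) * deriv f z = \<Phi> z"
        using one 3(3)[OF z] by (simp add: mult.assoc)
      moreover have "cnj (?\<Psi> (f z)) * cnj (deriv f z) = cnj (\<Phi> z)"
        unfolding e[symmetric] by simp
      ultimately show "has_wirt (\<lambda>w. complex_of_real (b (f w))) (\<Phi> z) (cnj (\<Phi> z)) z" by simp
    qed
  qed
qed

section \<open>Cauchy transform\<close>

text \<open>Lebesgue measure on the rectangle \<^term>\<open>cbox l u\<close>, as a product measure so that Fubini applies;
  \<^term>\<open>pt\<close> maps coordinates to points of the plane.\<close>

definition rect_measure :: "complex \<Rightarrow> complex \<Rightarrow> (real \<times> real) measure" where
  "rect_measure l u = restrict_space lborel {Re l..Re u} \<Otimes>\<^sub>M restrict_space lborel {Im l..Im u}"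

definition pt :: "real \<times> real \<Rightarrow> complex" where
  "pt p = of_real (fst p) + \<i> * of_real (snd p)"

lemma pt_simps [simp]: "Re (pt p) = fst p" "Im (pt p) = snd p"
  by (simp_all add: pt_def)

lemma finite_measure_interval: "finite_measure (restrict_space lborel {a..b::real})"
  by (rule finite_measureI) (cases "a \<le> b"; simp add: emeasure_restrict_space)

interpretation interval: finite_measure "restrict_space lborel {a..b::real}" for a b
  by (rule finite_measure_interval)

interpretation square: pair_sigma_finite "restrict_space lborel {a..b::real}" "restrict_space lborel {c..d::real}" for a b c d
  by (simp add: pair_sigma_finite_def interval.sigma_finite_measure_axioms)

interpretation rect_measure: finite_measure "rect_measure l u" for l u
  unfolding rect_measure_def by (intro finite_measure_pair_measure finite_measure_interval)

lemma pt_measurable [measurable]: "pt \<in> borel_measurable (rect_measure l u)"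
proof -
  have "(\<lambda>p. fst p) \<in> rect_measure l u \<rightarrow>\<^sub>M restrict_space lborel {Re l..Re u}"
    "(\<lambda>p. snd p) \<in> rect_measure l u \<rightarrow>\<^sub>M restrict_space lborel {Im l..Im u}"
    unfolding rect_measure_def by simp_all
  moreover have "(\<lambda>x. x) \<in> borel_measurable (restrict_space lborel A)" for A :: "real set"
    by (rule measurable_restrict_space1) simp
  ultimately have [measurable]: "fst \<in> borel_measurable (rect_measure l u)" "snd \<in> borel_measurable (rect_measure l u)"
    using measurable_compose by blast+
  show ?thesis unfolding pt_def[abs_def] by measurable
qed

lemma AE_interval_neq: "AE x in restrict_space lborel {a..b::real}. x \<noteq> c"
  by (subst AE_restrict_space_iff) (auto intro: AE_mp[OF AE_lborel_singleton])

lemma AE_rect_measure_neq: "AE p in rect_measure l u. fst p \<noteq> x \<and> snd p \<noteq> y"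
  unfolding rect_measure_def
proof (rule square.AE_pair_measure)
  let ?N = "restrict_space lborel {Re l..Re u} \<Otimes>\<^sub>M restrict_space lborel {Im l..Im u}"
  have "{p \<in> space (rect_measure l u). Re (pt p) \<noteq> x \<and> Im (pt p) \<noteq> y} \<in> sets (rect_measure l u)"
    by measurable
  then show "{p \<in> space ?N. fst p \<noteq> x \<and> snd p \<noteq> y} \<in> sets ?N"
    by (simp add: rect_measure_def)
  show "AE a in restrict_space lborel {Re l..Re u}. AE b in restrict_space lborel {Im l..Im u}.
      fst (a, b) \<noteq> x \<and> snd (a, b) \<noteq> y"
    using AE_interval_neq[of x "Re l" "Re u"]
  proof eventually_elim
    case (elim a)
    show ?case using AE_interval_neq[of y "Im l" "Im u"] by eventually_elim (use elim in simp)
  qed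
qed

lemma AE_rect_measure_pt_neq: "AE p in rect_measure l u. pt p \<noteq> z"
  using AE_rect_measure_neq[of "Re z" "Im z" l u] by eventually_elim auto

section \<open>Uniform bounds for weakly singular kernels\<close>

lemma powr_measurable_interval [measurable]:
  "(\<lambda>x. ennreal (\<bar>x - c\<bar> powr r)) \<in> borel_measurable (restrict_space lborel {a..b::real})"
  by (rule measurable_restrict_space1) simp

text \<open>Uniformity in \<open>c\<close> is the point, since the singularity moves with the
  argument of the transform.\<close>

lemma nn_integral_powr_line_bound:
  fixes r :: real
  assumes "0 \<le> r" "r < 1"
  shows "\<exists>B::real. B \<ge> 0 \<and> (\<forall>c. (\<integral>\<^sup>+x. ennreal (\<bar>x - c\<bar> powr (- r)) \<partial>restrict_space lborel {a..b}) \<le> ennreal B)"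
proof -
  have pos: "(\<integral>\<^sup>+x. ennreal (x powr (- r) * indicator {0..1} x) \<partial>lborel) = ennreal (1 / (1 - r))"
  proof (rule nn_integral_has_integral_lborel)
    have "((\<lambda>x. x powr (- r)) has_integral (1 powr (- r + 1) / (- r + 1))) {0..1}"
      using assms by (intro has_integral_powr_from_0) auto
    then have "((\<lambda>x. if x \<in> {0..1} then x powr (- r) else 0) has_integral (1 / (1 - r))) UNIV"
      by (subst has_integral_restrict_UNIV) simp
    then show "((\<lambda>x. x powr (- r) * indicator {0..1} x) has_integral (1 / (1 - r))) UNIV"
      by (rule has_integral_eq[rotated]) (auto simp: indicator_def)
  qed auto
  have neg: "(\<integral>\<^sup>+x. ennreal ((- x) powr (- r) * indicator {0..1} (- x)) \<partial>lborel) = ennreal (1 / (1 - r))"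
    using nn_integral_real_affine[of "\<lambda>x. ennreal (x powr (- r) * indicator {0..1} x)" "-1" 0] pos by simp
  show ?thesis
  \<comment> \<open>Each side of the singularity contributes at most \<open>1 / (1 - r)\<close>
    within distance 1; farther away the integrand is at most 1 and contributes at most the length of
    the interval.\<close>
  proof (intro exI[of _ "2 * (1 / (1 - r)) + max 0 (b - a)"] conjI allI)
    fix c :: real
    have "(\<integral>\<^sup>+x. ennreal (\<bar>x - c\<bar> powr (- r)) \<partial>restrict_space lborel {a..b})
        = (\<integral>\<^sup>+x. ennreal (\<bar>x - c\<bar> powr (- r)) * indicator {a..b} x \<partial>lborel)"
      by (rule nn_integral_restrict_space) simp
    also have "\<dots> = (\<integral>\<^sup>+x. ennreal (\<bar>(c + 1 * x) - c\<bar> powr (- r)) * indicator {a..b} (c + 1 * x) \<partial>lborel)"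
      by (subst nn_integral_real_affine[where c = 1 and t = c]) auto
    also have "\<dots> \<le> (\<integral>\<^sup>+x. ennreal (x powr (- r) * indicator {0..1} x)
        + (ennreal ((- x) powr (- r) * indicator {0..1} (- x)) + indicator {a..b} (c + 1 * x)) \<partial>lborel)"
    proof (rule nn_integral_mono)
      fix x :: real
      have "\<bar>x\<bar> powr (- r) \<le> 1" if "\<bar>x\<bar> > 1"
        using that assms by (simp add: powr_minus_divide ge_one_powr_ge_zero)
      then have "ennreal (\<bar>x\<bar> powr (- r)) \<le> 1" if "\<bar>x\<bar> > 1"
        using that by (metis ennreal_1 ennreal_leI)
      then show "ennreal (\<bar>(c + 1 * x) - c\<bar> powr (- r)) * indicator {a..b} (c + 1 * x) \<le>
          ennreal (x powr (- r) * indicator {0..1} x)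
        + (ennreal ((- x) powr (- r) * indicator {0..1} (- x)) + indicator {a..b} (c + 1 * x))"
        by (cases "\<bar>x\<bar> \<le> 1"; cases "x \<ge> 0") (auto simp: indicator_def)
    qed
    also have "\<dots> = ennreal (1 / (1 - r)) + (ennreal (1 / (1 - r)) + (\<integral>\<^sup>+x. indicator {a..b} (c + 1 * x) \<partial>lborel))"
      by (subst nn_integral_add, simp, simp, subst nn_integral_add, simp, simp, simp only: pos neg)
    also have "(\<integral>\<^sup>+x. indicator {a..b} (c + 1 * x) \<partial>lborel) = (\<integral>\<^sup>+x. indicator {a..b} x \<partial>lborel)"
      by (subst (2) nn_integral_real_affine[where c = 1 and t = c]) auto
    also have "\<dots> = ennreal (max 0 (b - a))"
      by (cases "a \<le> b") (auto simp: max_def)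
    also have "ennreal (1 / (1 - r)) + (ennreal (1 / (1 - r)) + ennreal (max 0 (b - a))) = ennreal (2 * (1 / (1 - r)) + max 0 (b - a))"
      using assms by (simp flip: ennreal_plus)
    finally show "(\<integral>\<^sup>+x. ennreal (\<bar>x - c\<bar> powr (- r)) \<partial>restrict_space lborel {a..b})
        \<le> ennreal (2 * (1 / (1 - r)) + max 0 (b - a))" .
  qed (use assms in auto)
qed

text \<open>Separates the variables: the planar kernel of order \<open>s\<close> is dominated by a
  product of one-dimensional kernels of order \<open>s / 2\<close>, so Fubini replaces polar
  coordinates.\<close>

lemma powr_norm_le_product:
  fixes z :: complex
  assumes "s \<ge> 0" "Re z \<noteq> 0" "Im z \<noteq> 0"
  shows "cmod z powr (- s) \<le> \<bar>Re z\<bar> powr (- (s / 2)) * \<bar>Im z\<bar> powr (- (s / 2))"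
proof -
  have "\<bar>Re z\<bar> * \<bar>Im z\<bar> \<le> cmod z ^ 2"
    using mult_mono[OF abs_Re_le_cmod abs_Im_le_cmod] by (simp add: power2_eq_square)
  then have "(cmod z ^ 2) powr (- (s / 2)) \<le> (\<bar>Re z\<bar> * \<bar>Im z\<bar>) powr (- (s / 2))"
    using assms by (intro powr_mono2') auto
  moreover have "(cmod z ^ 2) powr (- (s / 2)) = cmod z powr (- s)"
  proof -
    have "cmod z ^ 2 = cmod z powr 2" by simp
    then show ?thesis by (simp only: powr_powr) simp
  qed
  ultimately show ?thesis by (simp add: powr_mult)
qed

text \<open>The product bound holds off the two lines through \<open>z\<close>, a null set, and
  \<open>s < 2\<close> is exactly what makes the factors of order \<open>s / 2\<close>
  integrable.\<close>

lemma riesz_kernel_bound: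
  assumes "0 \<le> s" "s < 2"
  obtains B where "B \<ge> 0"
    and "\<And>z. integrable (rect_measure l u) (\<lambda>p. cmod (pt p - z) powr (- s))"
    and "\<And>z. (LINT p|rect_measure l u. cmod (pt p - z) powr (- s)) \<le> B"
proof -
  obtain B1 B2 :: real where B: "B1 \<ge> 0" "B2 \<ge> 0"
    "\<And>c. (\<integral>\<^sup>+x. ennreal (\<bar>x - c\<bar> powr (- (s / 2))) \<partial>restrict_space lborel {Re l..Re u}) \<le> ennreal B1"
    "\<And>c. (\<integral>\<^sup>+x. ennreal (\<bar>x - c\<bar> powr (- (s / 2))) \<partial>restrict_space lborel {Im l..Im u}) \<le> ennreal B2"
    using nn_integral_powr_line_bound[of "s / 2"] assms by (metis divide_less_eq_numeral1(1) half_gt_zero_iff less_eq_real_def mult_1 zero_less_numeral divide_nonneg_pos)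
  have le: "(\<integral>\<^sup>+p. ennreal (cmod (pt p - z) powr (- s)) \<partial>rect_measure l u) \<le> ennreal (B1 * B2)" for z
  proof -
    let ?f = "\<lambda>p. ennreal (\<bar>Re (pt p) - Re z\<bar> powr (- (s / 2))) * ennreal (\<bar>Im (pt p) - Im z\<bar> powr (- (s / 2)))"
    have "(\<integral>\<^sup>+p. ennreal (cmod (pt p - z) powr (- s)) \<partial>rect_measure l u) \<le> (\<integral>\<^sup>+p. ?f p \<partial>rect_measure l u)"
    proof (rule nn_integral_mono_AE)
      show "AE p in rect_measure l u. ennreal (cmod (pt p - z) powr (- s)) \<le> ?f p"
        using AE_rect_measure_neq[of "Re z" "Im z" l u]
      proof eventually_elim
        case (elim p)
        then show ?case
          using powr_norm_le_product[OF assms(1), of "pt p - z"]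
          by (subst ennreal_mult[symmetric]) (auto intro!: ennreal_leI)
      qed
    qed
    also have "\<dots> = (\<integral>\<^sup>+x. (\<integral>\<^sup>+y. ?f (x, y) \<partial>restrict_space lborel {Im l..Im u}) \<partial>restrict_space lborel {Re l..Re u})"
    proof -
      have "?f \<in> borel_measurable (rect_measure l u)" by measurable
      then show ?thesis unfolding rect_measure_def by (rule interval.nn_integral_fst[symmetric])
    qed
    also have "\<dots> = (\<integral>\<^sup>+x. ennreal (\<bar>x - Re z\<bar> powr (- (s / 2))) *
         (\<integral>\<^sup>+y. ennreal (\<bar>y - Im z\<bar> powr (- (s / 2))) \<partial>restrict_space lborel {Im l..Im u}) \<partial>restrict_space lborel {Re l..Re u})"
      unfolding pt_simps fst_conv snd_conv
      by (intro nn_integral_cong nn_integral_cmult powr_measurable_interval)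
    also have "\<dots> = (\<integral>\<^sup>+x. ennreal (\<bar>x - Re z\<bar> powr (- (s / 2))) \<partial>restrict_space lborel {Re l..Re u}) *
         (\<integral>\<^sup>+y. ennreal (\<bar>y - Im z\<bar> powr (- (s / 2))) \<partial>restrict_space lborel {Im l..Im u})"
      by (intro nn_integral_multc powr_measurable_interval)
    also have "\<dots> \<le> ennreal B1 * ennreal B2" by (intro mult_mono B) auto
    finally show ?thesis using B by (simp add: ennreal_mult)
  qed
  have int: "integrable (rect_measure l u) (\<lambda>p. cmod (pt p - z) powr (- s))" for z
    using le[of z] by (intro integrableI_nonneg) (auto simp: top_unique intro: le_less_trans)
  show thesis
  proof
    show "B1 * B2 \<ge> 0" using B by simp
    show "integrable (rect_measure l u) (\<lambda>p. cmod (pt p - z) powr (- s))" for z by (rule int)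
    show "(LINT p|rect_measure l u. cmod (pt p - z) powr (- s)) \<le> B1 * B2" for z
    proof -
      have "ennreal (LINT p|rect_measure l u. cmod (pt p - z) powr (- s)) = (\<integral>\<^sup>+p. ennreal (cmod (pt p - z) powr (- s)) \<partial>rect_measure l u)"
        by (rule nn_integral_eq_integral[OF int, symmetric]) simp
      then have "ennreal (LINT p|rect_measure l u. cmod (pt p - z) powr (- s)) \<le> ennreal (B1 * B2)"
        using le[of z] by (simp only:)
      then show ?thesis using B(1,2) by (subst (asm) ennreal_le_iff) auto
    qed
  qed
qed

text \<open>To be read with \<open>a\<close>, \<open>b\<close> the distances of the integration
  point from \<open>z\<close>, \<open>z'\<close> and \<open>w\<close> the distance of
  \<open>z\<close> from \<open>z'\<close>. Only half of \<open>\<alpha>\<close> is spent on the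
  power of \<open>w\<close>: the other half keeps the singularities at order
  \<open>2 - \<alpha> / 2\<close>, whereas spending all of it would leave the non-integrable order
  2. The proof uses that \<open>w\<close> is at most twice the larger of \<open>a\<close> and
  \<open>b\<close>.\<close>

lemma powr_kernel_split:
  fixes a b w \<alpha> :: real
  assumes "0 < a" "0 < b" "0 < w" "w \<le> a + b" "0 < \<alpha>" "\<alpha> \<le> 1"
  shows "w\<^sup>2 * a powr (\<alpha> - 2) / b \<le> 2 * w powr (1 + \<alpha> / 2) * (a powr (- (2 - \<alpha> / 2)) + b powr (- (2 - \<alpha> / 2)))"
proof -
  have key: "w powr (1 - \<alpha> / 2) * a powr (\<alpha> - 2) * b powr (- 1) \<le> 2 * (a powr (- (2 - \<alpha> / 2)) + b powr (- (2 - \<alpha> / 2)))"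
  proof -
    have two: "(2::real) powr (1 - \<alpha> / 2) \<le> 2" using assms powr_mono[of "1 - \<alpha> / 2" 1 2] by simp
    show ?thesis
    proof (cases "a \<le> b")
      case True
      have "w powr (1 - \<alpha> / 2) \<le> (2 * b) powr (1 - \<alpha> / 2)"
        using assms True by (intro powr_mono2) auto
      also have "\<dots> \<le> 2 * b powr (1 - \<alpha> / 2)"
        using two by (simp add: powr_mult mult_right_mono)
      finally have "w powr (1 - \<alpha> / 2) * a powr (\<alpha> - 2) * b powr (- 1) \<le> 2 * b powr (1 - \<alpha> / 2) * a powr (\<alpha> - 2) * b powr (- 1)"
        by (intro mult_right_mono) auto
      also have "\<dots> = 2 * (a powr (\<alpha> - 2) * (b powr (1 - \<alpha> / 2) * b powr (- 1)))" by (simp add: ac_simps)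
      also have "b powr (1 - \<alpha> / 2) * b powr (- 1) = b powr (- (\<alpha> / 2))"
        by (simp only: powr_add[symmetric]) simp
      also have "\<dots> \<le> a powr (- (\<alpha> / 2))"
        using assms True by (intro powr_mono2') auto
      also have "a powr (\<alpha> - 2) * a powr (- (\<alpha> / 2)) = a powr (- (2 - \<alpha> / 2))"
        by (simp add: powr_add[symmetric] algebra_simps)
      finally show ?thesis by (smt (verit) mult_left_mono powr_ge_zero)
    next
      case False
      have "w powr (1 - \<alpha> / 2) \<le> (2 * a) powr (1 - \<alpha> / 2)"
        using assms False by (intro powr_mono2) auto
      also have "\<dots> \<le> 2 * a powr (1 - \<alpha> / 2)"
        using two by (simp add: powr_mult mult_right_mono)
      finally have "w powr (1 - \<alpha> / 2) * a powr (\<alpha> - 2) * b powr (- 1) \<le> 2 * a powr (1 - \<alpha> / 2) * a powr (\<alpha> - 2) * b powr (- 1)"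
        by (intro mult_right_mono) auto
      also have "\<dots> = 2 * (b powr (- 1) * (a powr (1 - \<alpha> / 2) * a powr (\<alpha> - 2)))" by (simp add: ac_simps)
      also have "a powr (1 - \<alpha> / 2) * a powr (\<alpha> - 2) = a powr (\<alpha> / 2 - 1)"
        by (simp add: powr_add[symmetric])
      also have "\<dots> \<le> b powr (\<alpha> / 2 - 1)"
        using assms False by (intro powr_mono2') auto
      also have "b powr (- 1) * b powr (\<alpha> / 2 - 1) = b powr (- (2 - \<alpha> / 2))"
        by (simp only: powr_add[symmetric]) simp
      finally show ?thesis by (smt (verit) mult_left_mono powr_ge_zero)
    qed
  qed
  have "w\<^sup>2 * a powr (\<alpha> - 2) / b = w powr (1 + \<alpha> / 2) * (w powr (1 - \<alpha> / 2) * a powr (\<alpha> - 2) * b powr (- 1))"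
  proof -
    have 1: "w\<^sup>2 = w powr (1 + \<alpha> / 2) * w powr (1 - \<alpha> / 2)"
      using assms by (simp add: powr_add[symmetric])
    have 2: "inverse b = b powr (- 1)" using assms by (simp add: powr_minus)
    show ?thesis unfolding divide_inverse 1 2 by (simp only: mult.assoc)
  qed
  also have "\<dots> \<le> w powr (1 + \<alpha> / 2) * (2 * (a powr (- (2 - \<alpha> / 2)) + b powr (- (2 - \<alpha> / 2))))"
    by (intro mult_left_mono key) auto
  finally show ?thesis by (simp only: mult.assoc mult.left_commute[of 2])
qed

text \<open>Without the factor \<^term>\<open>- 1 / pi\<close>, these are the Cauchy transform of the restriction of \<^term>\<open>g\<close>
  to \<^term>\<open>cbox l u\<close> and its Beurling transform; subtracting \<^term>\<open>g z\<close> in the latter makes the integral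
  converge absolutely for Hoelder continuous \<^term>\<open>g\<close>.\<close>

definition cauchy_tr :: "complex \<Rightarrow> complex \<Rightarrow> (complex \<Rightarrow> complex) \<Rightarrow> complex \<Rightarrow> complex" where
  "cauchy_tr l u g z = (LINT p|rect_measure l u. g (pt p) / (pt p - z))"

definition beurling_tr :: "complex \<Rightarrow> complex \<Rightarrow> (complex \<Rightarrow> complex) \<Rightarrow> complex \<Rightarrow> complex" where
  "beurling_tr l u g z = (LINT p|rect_measure l u. (g (pt p) - g z) / (pt p - z)\<^sup>2)"

lemma integrable_cauchy_kernel:
  assumes [measurable]: "g \<in> borel_measurable borel" and M: "\<And>x. cmod (g x) \<le> M"
  shows "integrable (rect_measure l u) (\<lambda>p. g (pt p) / (pt p - z))"
proof -
  obtain B where "\<And>z. integrable (rect_measure l u) (\<lambda>p. cmod (pt p - z) powr (- 1))"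
    using riesz_kernel_bound[of 1 l u] by auto
  then have "integrable (rect_measure l u) (\<lambda>p. M * cmod (pt p - z) powr (- 1))" by (intro integrable_mult_right)
  then show ?thesis
  proof (rule Bochner_Integration.integrable_bound)
    show "AE p in rect_measure l u. cmod (g (pt p) / (pt p - z)) \<le> norm (M * cmod (pt p - z) powr (- 1))"
    proof (rule AE_I2)
      fix p
      have "M \<ge> 0" using order_trans[OF norm_ge_zero M] .
      then show "cmod (g (pt p) / (pt p - z)) \<le> norm (M * cmod (pt p - z) powr (- 1))"
        using M[of "pt p"]
        by (cases "pt p = z") (simp_all add: norm_divide powr_minus abs_mult divide_right_mono flip: divide_inverse)
    qed
  qed measurable
qed

lemma hoelder_kernel_bound:
  assumes "0 < \<alpha>" "\<alpha> \<le> 1" and hoe: "\<And>x y. cmod (g x - g y) \<le> C * cmod (x - y) powr \<alpha>"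
  shows "cmod ((g x - g z) / (x - z)\<^sup>2) \<le> C * cmod (x - z) powr (- (2 - \<alpha>))"
proof (cases "x = z")
  case False
  then have "cmod ((g x - g z) / (x - z)\<^sup>2) \<le> C * cmod (x - z) powr \<alpha> / cmod (x - z) ^ 2"
    using hoe[of x z] by (simp add: norm_divide norm_power divide_right_mono)
  also have "\<dots> = C * cmod (x - z) powr (- (2 - \<alpha>))"
    using False by (simp add: powr_diff)
  finally show ?thesis .
qed simp

lemma integrable_beurling_kernel:
  assumes "0 < \<alpha>" "\<alpha> \<le> 1" and [measurable]: "g \<in> borel_measurable borel"
    and hoe: "\<And>x y. cmod (g x - g y) \<le> C * cmod (x - y) powr \<alpha>"
  shows "integrable (rect_measure l u) (\<lambda>p. (g (pt p) - g z) / (pt p - z)\<^sup>2)"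
proof -
  obtain B where "\<And>z. integrable (rect_measure l u) (\<lambda>p. cmod (pt p - z) powr (- (2 - \<alpha>)))"
    using riesz_kernel_bound[of "2 - \<alpha>" l u thesis] assms(1,2) by force
  then have "integrable (rect_measure l u) (\<lambda>p. C * cmod (pt p - z) powr (- (2 - \<alpha>)))"
    by (intro integrable_mult_right)
  then show "integrable (rect_measure l u) (\<lambda>p. (g (pt p) - g z) / (pt p - z)\<^sup>2)"
  proof (rule Bochner_Integration.integrable_bound)
    show "AE p in rect_measure l u. cmod ((g (pt p) - g z) / (pt p - z)\<^sup>2) \<le> norm (C * cmod (pt p - z) powr (- (2 - \<alpha>)))"
      using hoelder_kernel_bound[OF assms(1,2) hoe] by (intro AE_I2) (metis abs_ge_self order_trans real_norm_def)
  qed measurable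
qed

lemma hoelder_const_nonneg:
  assumes "\<And>x y::complex. cmod (g x - g y) \<le> C * cmod (x - y) powr \<alpha>"
  shows "C \<ge> 0"
  using order_trans[OF norm_ge_zero assms[of 1 0]] by simp

text \<open>Subtracting \<open>g z\<close> times the transform of 1 leaves the factor
  \<open>g (pt p) - g z\<close>, and the second-order remainder of \<open>1 / (pt p - z)\<close> is
  \<open>(z' - z)\<^sup>2 / ((pt p - z') * (pt p - z)\<^sup>2)\<close>. Hoelder continuity and the
  kernel splitting bound the product. As \<open>D\<close> serves all points, the expansion yields
  both the derivatives and their Hoelder continuity.\<close>

lemma cauchy_tr_expansion:
  assumes \<alpha>: "0 < \<alpha>" "\<alpha> \<le> 1" and [measurable]: "g \<in> borel_measurable borel"
    and M: "\<And>x. cmod (g x) \<le> M"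
    and hoe: "\<And>x y. cmod (g x - g y) \<le> C * cmod (x - y) powr \<alpha>"
  obtains D where "\<And>z z'. cmod (cauchy_tr l u g z' - cauchy_tr l u g z
      - g z * (cauchy_tr l u (\<lambda>_. 1) z' - cauchy_tr l u (\<lambda>_. 1) z) - (z' - z) * beurling_tr l u g z)
      \<le> D * cmod (z' - z) powr (1 + \<alpha> / 2)"
proof -
  obtain B where B: "\<And>z. integrable (rect_measure l u) (\<lambda>p. cmod (pt p - z) powr (- (2 - \<alpha> / 2)))"
    "\<And>z. (LINT p|rect_measure l u. cmod (pt p - z) powr (- (2 - \<alpha> / 2))) \<le> B"
    using riesz_kernel_bound[of "2 - \<alpha> / 2" l u thesis] \<alpha> by force
  have C: "C \<ge> 0" using hoe by (rule hoelder_const_nonneg)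
  show thesis
  proof (rule that[of "C * 2 * (B + B)"])
    fix z z'
    show "cmod (cauchy_tr l u g z' - cauchy_tr l u g z
      - g z * (cauchy_tr l u (\<lambda>_. 1) z' - cauchy_tr l u (\<lambda>_. 1) z) - (z' - z) * beurling_tr l u g z)
      \<le> C * 2 * (B + B) * cmod (z' - z) powr (1 + \<alpha> / 2)"
    proof (cases "z' = z")
      case False
      let ?w = "cmod (z' - z)"
      define F where "F p = g (pt p) / (pt p - z') - g (pt p) / (pt p - z)
          - g z * (1 / (pt p - z') - 1 / (pt p - z)) - (z' - z) * ((g (pt p) - g z) / (pt p - z)\<^sup>2)" for p
      define G where "G p = C * 2 * ?w powr (1 + \<alpha> / 2) *
          (cmod (pt p - z) powr (- (2 - \<alpha> / 2)) + cmod (pt p - z') powr (- (2 - \<alpha> / 2)))" for p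
      note ig = integrable_cauchy_kernel[OF \<open>g \<in> borel_measurable borel\<close> M]
      have i1: "integrable (rect_measure l u) (\<lambda>p. 1 / (pt p - z))" for z
        by (rule integrable_cauchy_kernel[of "\<lambda>_. 1" 1]) auto
      note ib = integrable_beurling_kernel[OF \<alpha> \<open>g \<in> borel_measurable borel\<close> hoe]
      have iF: "integrable (rect_measure l u) F"
        unfolding F_def by (intro Bochner_Integration.integrable_diff integrable_mult_right ig i1 ib)
      have iG: "integrable (rect_measure l u) G"
        unfolding G_def by (intro integrable_mult_right Bochner_Integration.integrable_add B(1))
      have "cauchy_tr l u g z' - cauchy_tr l u g z
        - g z * (cauchy_tr l u (\<lambda>_. 1) z' - cauchy_tr l u (\<lambda>_. 1) z) - (z' - z) * beurling_tr l u g z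
        = (LINT p|rect_measure l u. F p)"
        unfolding F_def cauchy_tr_def beurling_tr_def
        by (simp only: Bochner_Integration.integral_diff Bochner_Integration.integrable_diff
            integrable_mult_right integral_mult_right_zero ig i1 ib)
      also have "cmod \<dots> \<le> (LINT p|rect_measure l u. cmod (F p))" by (rule integral_norm_bound)
      also have "\<dots> \<le> (LINT p|rect_measure l u. G p)"
      proof (rule integral_mono_AE[OF integrable_norm[OF iF] iG])
        show "AE p in rect_measure l u. cmod (F p) \<le> G p"
          using AE_rect_measure_pt_neq[of z l u] AE_rect_measure_pt_neq[of z' l u]
        proof eventually_elim
          case (elim p)
          let ?a = "cmod (pt p - z)" and ?b = "cmod (pt p - z')"
          have ne: "pt p - z \<noteq> 0" "pt p - z' \<noteq> 0" using elim by auto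
          have "F p = (g (pt p) - g z) * (1 / (pt p - z') - 1 / (pt p - z) - (z' - z) / (pt p - z)\<^sup>2)"
            by (simp add: F_def algebra_simps diff_divide_distrib)
          also have "1 / (pt p - z') - 1 / (pt p - z) - (z' - z) / (pt p - z)\<^sup>2
             = (z' - z)\<^sup>2 / ((pt p - z') * (pt p - z)\<^sup>2)"
          proof -
            have "1 / y - 1 / x - (x - y) / x\<^sup>2 = (x - y)\<^sup>2 / (y * x\<^sup>2)" if "x \<noteq> 0" "y \<noteq> 0" for x y :: complex
              using that by (simp add: field_simps power2_eq_square)
            from this[OF ne] show ?thesis by simp
          qed
          also have "(g (pt p) - g z) * \<dots> = ((g (pt p) - g z) / (pt p - z)\<^sup>2) * ((z' - z)\<^sup>2 / (pt p - z'))"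
            by simp
          finally have "cmod (F p) = cmod ((g (pt p) - g z) / (pt p - z)\<^sup>2) * (?w\<^sup>2 / ?b)"
            by (simp only: norm_mult norm_divide norm_power)
          also have "\<dots> \<le> C * ?a powr (- (2 - \<alpha>)) * (?w\<^sup>2 / ?b)"
            by (intro mult_right_mono hoelder_kernel_bound[OF \<alpha> hoe]) auto
          also have "\<dots> = C * (?w\<^sup>2 * ?a powr (\<alpha> - 2) / ?b)" by simp
          also have "\<dots> \<le> C * (2 * ?w powr (1 + \<alpha> / 2) * (?a powr (- (2 - \<alpha> / 2)) + ?b powr (- (2 - \<alpha> / 2))))"
          proof (intro mult_left_mono powr_kernel_split \<alpha> C)
            show "?w \<le> ?a + ?b" using norm_triangle_ineq4[of "pt p - z" "pt p - z'"] by simp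
          qed (use ne False in auto)
          also have "\<dots> = G p" by (simp add: G_def)
          finally show ?case .
        qed
      qed
      also have "\<dots> = C * 2 * ?w powr (1 + \<alpha> / 2) *
          ((LINT p|rect_measure l u. cmod (pt p - z) powr (- (2 - \<alpha> / 2))) + (LINT p|rect_measure l u. cmod (pt p - z') powr (- (2 - \<alpha> / 2))))"
        unfolding G_def by (simp only: integral_mult_right_zero Bochner_Integration.integral_add B(1))
      also have "\<dots> \<le> C * 2 * ?w powr (1 + \<alpha> / 2) * (B + B)"
        using C by (intro mult_left_mono add_mono B(2)) auto
      finally show ?thesis by (simp add: ac_simps)
    qed simp
  qed
qed

lemma has_wirt_zeroI:
  assumes "\<And>w. cmod (f w - f z) \<le> D * cmod (w - z) powr (1 + \<beta>)" "\<beta> > 0"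
  shows "has_wirt f 0 0 z"
  unfolding has_wirt_def has_derivative_at2
proof (intro conjI)
  have "((\<lambda>w. D * cmod (w - z) powr \<beta>) \<longlongrightarrow> D * 0) (at z)"
  proof (intro tendsto_mult tendsto_const)
    have "((\<lambda>w. cmod (w - z)) \<longlongrightarrow> 0) (at z)"
      by (auto intro!: tendsto_eq_intros)
    from tendsto_powr'[OF this tendsto_const, of \<beta>] show "((\<lambda>w. cmod (w - z) powr \<beta>) \<longlongrightarrow> 0) (at z)"
      using assms(2) by simp
  qed
  then have "((\<lambda>w. D * cmod (w - z) powr \<beta>) \<longlongrightarrow> 0) (at z)" by simp
  then show "(\<lambda>w. (1 / cmod (w - z)) *\<^sub>R (f w - (f z + (0 * (w - z) + 0 * cnj (w - z))))) \<midarrow>z\<rightarrow> 0"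
  proof (rule Lim_null_comparison[rotated], intro eventually_at_filter[THEN iffD2] always_eventually allI impI)
    fix w assume "w \<noteq> z"
    then have "D * cmod (w - z) powr (1 + \<beta>) = cmod (w - z) * (D * cmod (w - z) powr \<beta>)"
      by (simp add: powr_add)
    moreover have "cmod ((1 / cmod (w - z)) *\<^sub>R (f w - (f z + (0 * (w - z) + 0 * cnj (w - z))))) = cmod (f w - f z) / cmod (w - z)"
      by (simp only: norm_scaleR) simp
    moreover have "cmod (f w - f z) / cmod (w - z) \<le> D * cmod (w - z) powr \<beta>"
      if "D * cmod (w - z) powr (1 + \<beta>) = cmod (w - z) * (D * cmod (w - z) powr \<beta>)"
      using assms(1)[of w] \<open>w \<noteq> z\<close> unfolding that by (simp add: divide_le_eq mult.commute)
    ultimately show "cmod ((1 / cmod (w - z)) *\<^sub>R (f w - (f z + (0 * (w - z) + 0 * cnj (w - z))))) \<le> D * cmod (w - z) powr \<beta>"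
      by (simp only:)
  qed
qed (auto intro: bounded_linear_intros)

section \<open>The transform of the constant 1 in closed form\<close>

lemma integral_interval_FTC:
  fixes f :: "real \<Rightarrow> complex"
  assumes "a \<le> b" "\<And>x. x \<in> {a..b} \<Longrightarrow> (F has_vector_derivative f x) (at x)" "continuous_on {a..b} f"
  shows "(LINT x|restrict_space lborel {a..b}. f x) = F b - F a"
proof -
  have "(LINT x|restrict_space lborel {a..b}. f x) = (LINT x|lborel. indicator {a..b} x *\<^sub>R f x)"
    by (subst integral_restrict_space) auto
  also have "\<dots> = F b - F a"
    by (rule integral_FTC_atLeastAtMost[OF assms(1) _ assms(3)], rule has_vector_derivative_at_within)
       (rule assms(2), simp)
  finally show ?thesis .
qed

lemma integrable_interval_continuous:
  fixes f :: "real \<Rightarrow> complex"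
  assumes "continuous_on {a..b} f"
  shows "integrable (restrict_space lborel {a..b}) f"
  using borel_integrable_atLeastAtMost'[OF assms]
  by (simp add: integrable_restrict_space set_integrable_def)

lemma LINT_sgn:
  fixes c :: real
  assumes "a \<le> c" "c \<le> b"
  shows "integrable (restrict_space lborel {a..b}) (\<lambda>y. complex_of_real (sgn (y - c)))" (is ?I)
    and "(LINT y|restrict_space lborel {a..b}. complex_of_real (sgn (y - c))) = of_real (a + b - 2 * c)" (is ?E)
proof -
  have m: "(\<lambda>y. sgn (y - c)) \<in> borel_measurable (restrict_space lborel {a..b})"
    by (rule measurable_restrict_space1) simp
  have "integrable (restrict_space lborel {a..b}) (\<lambda>y. sgn (y - c))"
    by (rule interval.integrable_const_bound[where B = 1, OF _ m]) (simp add: sgn_if)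
  then show ?I by simp
  have "(LINT y|restrict_space lborel {a..b}. sgn (y - c)) = (LINT y|lborel. indicator {a..b} y *\<^sub>R sgn (y - c))"
    by (subst integral_restrict_space) auto
  also have "\<dots> = (LINT y|lborel. indicator {c..b} y - indicator {a..c} y)"
  proof (rule integral_cong_AE)
    show "AE y in lborel. indicator {a..b} y *\<^sub>R sgn (y - c) = indicator {c..b} y - indicator {a..c} y"
      using AE_lborel_singleton[of c] by eventually_elim (use assms in \<open>auto simp: indicator_def sgn_if\<close>)
  qed simp_all
  also have "\<dots> = (b - c) - (c - a)"
    using assms by (subst Bochner_Integration.integral_diff) (auto simp: integrable_indicator_iff)
  finally have "(LINT y|restrict_space lborel {a..b}. sgn (y - c)) = a + b - 2 * c" by simp
  then show ?E by (simp only: integral_complex_of_real)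
qed

lemma has_field_derivative_Ln_primitive:
  assumes "Re z > 0"
  shows "((\<lambda>z. z * Ln z - z) has_field_derivative Ln z) (at z)"
proof -
  have "z \<notin> \<real>\<^sub>\<le>\<^sub>0" "z \<noteq> 0" using assms by (auto simp: complex_nonpos_Reals_iff)
  then show ?thesis by (auto intro!: derivative_eq_intros)
qed

text \<open>Explicit integration, first in \<open>x\<close>, then in \<open>y\<close>. The only
  non-holomorphic contribution is the jump of the logarithm across the height \<open>Im z\<close>;
  it integrates to \<open>2 * \<i> * pi * Im z\<close>, which is \<open>pi * (z - cnj z)\<close>,
  and a constant.\<close>

lemma cauchy_tr_1:
  obtains H where "H holomorphic_on box l u"
    and "\<And>z. z \<in> box l u \<Longrightarrow> cauchy_tr l u (\<lambda>_. 1) z = H z + pi * (z - cnj z)"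
proof -
  define L where "L z = z * Ln z - z" for z :: complex
  \<comment> \<open>The four terms are the primitive \<open>L\<close> of \<open>Ln\<close> at the
    corners of the box relative to \<open>z\<close>, with the sign reversed at the two left corners
    so that every argument has positive real part and avoids the branch cut.\<close>
  define H where "H z = - \<i> * (L (Re u - z + \<i> * Im u) - L (Re u - z + \<i> * Im l))
     - \<i> * (L (z - Re l - \<i> * Im u) - L (z - Re l - \<i> * Im l)) - \<i> * pi * (Im l + Im u)" for z :: complex
  show thesis
  proof
    have L: "L holomorphic_on {z. Re z > 0}"
    proof (rule holomorphic_onI)
      fix z :: complex assume "z \<in> {z. Re z > 0}"
      then have "(L has_field_derivative Ln z) (at z)"
        unfolding L_def by (intro has_field_derivative_Ln_primitive) simp
      then show "L field_differentiable at z within {z. Re z > 0}"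
        using field_differentiable_def field_differentiable_at_within by blast
    qed
    have "(\<lambda>z. L (f z)) holomorphic_on box l u"
      if "f holomorphic_on box l u" "\<And>z. z \<in> box l u \<Longrightarrow> Re (f z) > 0" for f
      using holomorphic_on_compose_gen[OF that(1) L] that(2) by (auto simp: o_def)
    note LH = this
    show "H holomorphic_on box l u"
      unfolding H_def by (intro holomorphic_intros LH) (auto simp: in_box_complex_iff)
  next
    fix z assume z: "z \<in> box l u"
    then have zz: "Re l < Re z" "Re z < Re u" "Im l < Im z" "Im z < Im u"
      by (auto simp: in_box_complex_iff)
    let ?M1 = "restrict_space lborel {Re l..Re u}" and ?M2 = "restrict_space lborel {Im l..Im u}"
    define A where "A y = Ln (Re u - z + \<i> * of_real y) - Ln (z - Re l - \<i> * of_real y)" for y :: real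
    have inner: "(LINT x|?M1. 1 / (pt (x, y) - z)) = A y - \<i> * pi * of_real (sgn (y - Im z))" if y: "y \<noteq> Im z" for y
    proof -
      have "(LINT x|?M1. 1 / (pt (x, y) - z)) = Ln (of_real (Re u) + \<i> * of_real y - z) - Ln (of_real (Re l) + \<i> * of_real y - z)"
      proof (rule integral_interval_FTC)
        show "Re l \<le> Re u" using zz by simp
        fix x :: real
        have "of_real x + \<i> * of_real y - z \<notin> \<real>\<^sub>\<le>\<^sub>0"
          using y by (simp add: complex_nonpos_Reals_iff)
        then have "((\<lambda>w. Ln (w + \<i> * of_real y - z)) has_field_derivative 1 / (of_real x + \<i> * of_real y - z)) (at (of_real x))"
          by (auto intro!: derivative_eq_intros simp: divide_inverse)
        then show "((\<lambda>x. Ln (of_real x + \<i> * of_real y - z)) has_vector_derivative 1 / (pt (x, y) - z)) (at x)"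
          by (auto simp: pt_def dest: has_vector_derivative_real_field)
      next
        show "continuous_on {Re l..Re u} (\<lambda>x. 1 / (pt (x, y) - z))"
          using y by (auto simp: pt_def complex_eq_iff intro!: continuous_intros)
      qed
      also have "Ln (of_real (Re l) + \<i> * of_real y - z) = Ln (- (z - Re l - \<i> * of_real y))" by (simp add: algebra_simps)
      \<comment> \<open>On the left edge the argument of \<open>Ln\<close> has negative real part.
        Passing to its negative costs \<open>\<i> * pi\<close> with the sign of
        \<open>y - Im z\<close>, and leaves a logarithm that is continuous in
        \<open>y\<close>.\<close>
      also have "\<dots> = Ln (z - Re l - \<i> * of_real y) + \<i> * pi * of_real (sgn (y - Im z))"
      proof -
        have "z - Re l - \<i> * of_real y \<noteq> 0" using y by (auto simp: complex_eq_iff)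
        from Ln_minus[OF this] show ?thesis using y zz by (auto simp: sgn_if)
      qed
      finally show ?thesis by (simp add: A_def algebra_simps)
    qed
    have cA: "continuous_on {Im l..Im u} A"
      unfolding A_def using zz by (intro continuous_intros) (auto simp: complex_nonpos_Reals_iff)
    have sg: "integrable ?M2 (\<lambda>y. \<i> * pi * complex_of_real (sgn (y - Im z)))"
      using LINT_sgn(1)[of "Im l" "Im z" "Im u"] zz by (intro integrable_mult_right) auto
    have pair: "(\<lambda>(x, y). 1 / (pt (x, y) - z)) = (\<lambda>p. 1 / (pt p - z))" by auto
    have int: "integrable (?M1 \<Otimes>\<^sub>M ?M2) (\<lambda>(x, y). 1 / (pt (x, y) - z))"
      using integrable_cauchy_kernel[of "\<lambda>_. 1" 1 l u z] by (simp add: rect_measure_def pair)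
    have "cauchy_tr l u (\<lambda>_. 1) z = integral\<^sup>L (?M1 \<Otimes>\<^sub>M ?M2) (\<lambda>(x, y). 1 / (pt (x, y) - z))"
      by (simp add: cauchy_tr_def rect_measure_def pair)
    also have "\<dots> = (LINT y|?M2. LINT x|?M1. 1 / (pt (x, y) - z))"
      by (rule square.integral_snd[OF int, symmetric])
    also have "\<dots> = (LINT y|?M2. A y - \<i> * pi * of_real (sgn (y - Im z)))"
    proof (rule integral_cong_AE)
      show "(\<lambda>y. LINT x|?M1. 1 / (pt (x, y) - z)) \<in> borel_measurable ?M2"
        using square.integrable_snd[OF int] by (rule borel_measurable_integrable)
      show "(\<lambda>y. A y - \<i> * pi * of_real (sgn (y - Im z))) \<in> borel_measurable ?M2"
        using integrable_interval_continuous[OF cA] sg by (intro borel_measurable_integrable Bochner_Integration.integrable_diff)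
      show "AE y in ?M2. (LINT x|?M1. 1 / (pt (x, y) - z)) = A y - \<i> * pi * of_real (sgn (y - Im z))"
        using AE_interval_neq[of "Im z" "Im l" "Im u"] by eventually_elim (rule inner)
    qed
    also have "\<dots> = (LINT y|?M2. A y) - (LINT y|?M2. \<i> * pi * of_real (sgn (y - Im z)))"
      by (rule Bochner_Integration.integral_diff[OF integrable_interval_continuous[OF cA] sg])
    also have "(LINT y|?M2. \<i> * pi * of_real (sgn (y - Im z))) = \<i> * pi * of_real (Im l + Im u - 2 * Im z)"
      by (subst integral_mult_right_zero) (use LINT_sgn(2)[of "Im l" "Im z" "Im u"] zz in simp)
    also have "(LINT y|?M2. A y) = (- \<i> * L (Re u - z + \<i> * of_real (Im u)) - \<i> * L (z - Re l - \<i> * of_real (Im u)))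
        - (- \<i> * L (Re u - z + \<i> * of_real (Im l)) - \<i> * L (z - Re l - \<i> * of_real (Im l)))"
    proof (rule integral_interval_FTC[OF _ _ cA])
      show "Im l \<le> Im u" using zz by simp
      fix y :: real
      have 1: "(L has_field_derivative Ln w) (at w)" if "Re w > 0" for w
        unfolding L_def[abs_def] by (rule has_field_derivative_Ln_primitive[OF that])
      have "((\<lambda>y. - \<i> * L (Re u - z + \<i> * y) - \<i> * L (z - Re l - \<i> * y)) has_field_derivative A y) (at (of_real y))"
      proof -
        have a: "((\<lambda>y. L (Re u - z + \<i> * y)) has_field_derivative Ln (Re u - z + \<i> * of_real y) * \<i>) (at (of_real y))"
          by (rule DERIV_chain2[OF 1]) (use zz in simp, auto intro!: derivative_eq_intros)
        have b: "((\<lambda>y. L (z - Re l - \<i> * y)) has_field_derivative Ln (z - Re l - \<i> * of_real y) * (- \<i>)) (at (of_real y))"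
          by (rule DERIV_chain2[OF 1]) (use zz in simp, auto intro!: derivative_eq_intros)
        show ?thesis
          by (rule DERIV_cong[OF DERIV_diff[OF DERIV_cmult[OF a, of "- \<i>"] DERIV_cmult[OF b, of \<i>]]])
             (simp add: A_def algebra_simps)
      qed
      then show "((\<lambda>y::real. - \<i> * L (Re u - z + \<i> * of_real y) - \<i> * L (z - Re l - \<i> * of_real y)) has_vector_derivative A y) (at y)"
        by (rule has_vector_derivative_real_field)
    qed
    finally show "cauchy_tr l u (\<lambda>_. 1) z = H z + pi * (z - cnj z)"
      by (simp add: H_def complex_diff_cnj algebra_simps)
  qed
qed

section \<open>Hoelder continuity of the derivatives of the Cauchy transform\<close>

definition hoelder_on :: "complex set \<Rightarrow> real \<Rightarrow> (complex \<Rightarrow> complex) \<Rightarrow> bool" where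
  "hoelder_on S \<alpha> g \<longleftrightarrow> (\<exists>C. \<forall>x\<in>S. \<forall>y\<in>S. cmod (g x - g y) \<le> C * cmod (x - y) powr \<alpha>)"

lemma hoelder_onI:
  "(\<And>x y. x \<in> S \<Longrightarrow> y \<in> S \<Longrightarrow> cmod (g x - g y) \<le> C * cmod (x - y) powr \<alpha>) \<Longrightarrow> hoelder_on S \<alpha> g"
  by (auto simp: hoelder_on_def)

lemma hoelder_onE:
  assumes "hoelder_on S \<alpha> g"
  obtains C where "C \<ge> 0" "\<And>x y. x \<in> S \<Longrightarrow> y \<in> S \<Longrightarrow> cmod (g x - g y) \<le> C * cmod (x - y) powr \<alpha>"
proof -
  obtain C where C: "\<And>x y. x \<in> S \<Longrightarrow> y \<in> S \<Longrightarrow> cmod (g x - g y) \<le> C * cmod (x - y) powr \<alpha>"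
    using assms by (auto simp: hoelder_on_def)
  show thesis
  proof (rule that[of "\<bar>C\<bar>"])
    fix x y assume "x \<in> S" "y \<in> S"
    then have "cmod (g x - g y) \<le> C * cmod (x - y) powr \<alpha>" by (rule C)
    also have "\<dots> \<le> \<bar>C\<bar> * cmod (x - y) powr \<alpha>" by (intro mult_right_mono) auto
    finally show "cmod (g x - g y) \<le> \<bar>C\<bar> * cmod (x - y) powr \<alpha>" .
  qed simp
qed

lemma hoelder_on_subset: "hoelder_on S \<alpha> g \<Longrightarrow> T \<subseteq> S \<Longrightarrow> hoelder_on T \<alpha> g"
  unfolding hoelder_on_def by blast

lemma hoelder_on_cong: "hoelder_on S \<alpha> g \<Longrightarrow> (\<And>x. x \<in> S \<Longrightarrow> g x = h x) \<Longrightarrow> hoelder_on S \<alpha> h"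
  unfolding hoelder_on_def by metis

lemma hoelder_on_continuous:
  assumes "hoelder_on S \<alpha> g" "\<alpha> > 0"
  shows "continuous_on S g"
  unfolding continuous_on_def
proof
  fix x assume x: "x \<in> S"
  obtain C where C: "\<And>x y. x \<in> S \<Longrightarrow> y \<in> S \<Longrightarrow> cmod (g x - g y) \<le> C * cmod (x - y) powr \<alpha>"
    using assms(1) by (rule hoelder_onE) blast
  have "((\<lambda>y. cmod (y - x)) \<longlongrightarrow> 0) (at x within S)"
    by (auto intro!: tendsto_eq_intros)
  from tendsto_mult[OF tendsto_const[of C] tendsto_powr'[OF this tendsto_const, of \<alpha>]]
  have "((\<lambda>y. C * cmod (y - x) powr \<alpha>) \<longlongrightarrow> 0) (at x within S)"
    using assms(2) by simp
  then have "((\<lambda>y. g y - g x) \<longlongrightarrow> 0) (at x within S)"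
    by (rule Lim_null_comparison[rotated]) (use C x in \<open>auto simp: eventually_at_filter\<close>)
  then show "(g \<longlongrightarrow> g x) (at x within S)" by (rule LIM_zero_cancel)
qed

lemma hoelder_on_weaken:
  assumes "hoelder_on S \<alpha> g" "bounded S" "0 < \<beta>" "\<beta> \<le> \<alpha>"
  shows "hoelder_on S \<beta> g"
proof -
  obtain C where C: "C \<ge> 0" "\<And>x y. x \<in> S \<Longrightarrow> y \<in> S \<Longrightarrow> cmod (g x - g y) \<le> C * cmod (x - y) powr \<alpha>"
    using assms(1) by (rule hoelder_onE) (rule that, assumption, blast)
  obtain d where d: "\<And>x y. x \<in> S \<Longrightarrow> y \<in> S \<Longrightarrow> dist x y \<le> d"
    using assms(2) unfolding bounded_two_points by blast
  show ?thesis
  proof (rule hoelder_onI[where C = "C * d powr (\<alpha> - \<beta>)"])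
    fix x y assume xy: "x \<in> S" "y \<in> S"
    have "cmod (x - y) powr \<alpha> = cmod (x - y) powr (\<alpha> - \<beta>) * cmod (x - y) powr \<beta>"
      by (simp add: powr_add[symmetric])
    also have "\<dots> \<le> d powr (\<alpha> - \<beta>) * cmod (x - y) powr \<beta>"
      using d[OF xy] assms by (intro mult_right_mono powr_mono2) (auto simp: dist_norm)
    finally show "cmod (g x - g y) \<le> C * d powr (\<alpha> - \<beta>) * cmod (x - y) powr \<beta>"
      using C(2)[OF xy] C(1) by (simp add: mult.assoc) (meson mult_left_mono order_trans)
  qed
qed

lemma hoelder_on_add:
  assumes "hoelder_on S \<alpha> f" "hoelder_on S \<alpha> g"
  shows "hoelder_on S \<alpha> (\<lambda>x. f x + g x)"
proof -
  obtain C where C: "\<And>x y. x \<in> S \<Longrightarrow> y \<in> S \<Longrightarrow> cmod (f x - f y) \<le> C * cmod (x - y) powr \<alpha>"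
    using assms(1) by (rule hoelder_onE) blast
  obtain D where D: "\<And>x y. x \<in> S \<Longrightarrow> y \<in> S \<Longrightarrow> cmod (g x - g y) \<le> D * cmod (x - y) powr \<alpha>"
    using assms(2) by (rule hoelder_onE) blast
  show ?thesis
  proof (rule hoelder_onI[where C = "C + D"])
    fix x y assume xy: "x \<in> S" "y \<in> S"
    have "cmod (f x + g x - (f y + g y)) \<le> cmod (f x - f y) + cmod (g x - g y)"
      using norm_triangle_ineq[of "f x - f y" "g x - g y"] by (simp add: algebra_simps)
    then show "cmod (f x + g x - (f y + g y)) \<le> (C + D) * cmod (x - y) powr \<alpha>"
      using C[OF xy] D[OF xy] by (simp add: distrib_right)
  qed
qed

lemma hoelder_on_mult:
  assumes "hoelder_on S \<alpha> f" "hoelder_on S \<alpha> g" "compact S" "\<alpha> > 0"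
  shows "hoelder_on S \<alpha> (\<lambda>x. f x * g x)"
proof -
  obtain C where C: "\<And>x y. x \<in> S \<Longrightarrow> y \<in> S \<Longrightarrow> cmod (f x - f y) \<le> C * cmod (x - y) powr \<alpha>"
    using assms(1) by (rule hoelder_onE) blast
  obtain D where D: "\<And>x y. x \<in> S \<Longrightarrow> y \<in> S \<Longrightarrow> cmod (g x - g y) \<le> D * cmod (x - y) powr \<alpha>"
    using assms(2) by (rule hoelder_onE) blast
  have "bounded (f ` S)" "bounded (g ` S)"
    using assms hoelder_on_continuous compact_continuous_image compact_imp_bounded by blast+
  then obtain M N where MN: "\<And>x. x \<in> S \<Longrightarrow> cmod (f x) \<le> M" "\<And>x. x \<in> S \<Longrightarrow> cmod (g x) \<le> N"
    unfolding bounded_iff by blast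
  show ?thesis
  proof (rule hoelder_onI[where C = "M * D + N * C"])
    fix x y assume xy: "x \<in> S" "y \<in> S"
    have "cmod (f x * g x - f y * g y) = cmod (f x * (g x - g y) + g y * (f x - f y))"
      by (simp add: algebra_simps)
    also have "\<dots> \<le> cmod (f x) * cmod (g x - g y) + cmod (g y) * cmod (f x - f y)"
      by (metis norm_mult norm_triangle_ineq)
    also have "\<dots> \<le> M * (D * cmod (x - y) powr \<alpha>) + N * (C * cmod (x - y) powr \<alpha>)"
      using xy MN[OF xy(1)] MN[OF xy(2)] by (intro add_mono mult_mono' MN C D) auto
    finally show "cmod (f x * g x - f y * g y) \<le> (M * D + N * C) * cmod (x - y) powr \<alpha>"
      by (simp add: algebra_simps)
  qed
qed

lemma hoelder_on_cnj: "hoelder_on S \<alpha> f \<Longrightarrow> hoelder_on S \<alpha> (\<lambda>x. cnj (f x))"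
  unfolding hoelder_on_def by (metis complex_cnj_diff complex_mod_cnj)

lemma hoelder_on_const: "hoelder_on S \<alpha> (\<lambda>x. c)"
  by (rule hoelder_onI[where C = 0]) simp

lemma has_wirt_lipschitz_compact:
  assumes "compact S" "convex S" "\<And>z. z \<in> S \<Longrightarrow> has_wirt f (A z) (B z) z"
    "continuous_on S A" "continuous_on S B"
  obtains L where "\<And>x y. x \<in> S \<Longrightarrow> y \<in> S \<Longrightarrow> cmod (f x - f y) \<le> L * cmod (x - y)"
proof -
  have "bounded ((\<lambda>z. cmod (A z) + cmod (B z)) ` S)"
    by (intro compact_imp_bounded compact_continuous_image continuous_intros assms)
  then obtain L where "\<And>z. z \<in> S \<Longrightarrow> cmod (A z) + cmod (B z) \<le> L"
    unfolding bounded_iff by (metis abs_le_D1 image_eqI real_norm_def)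
  then show thesis using that has_wirt_norm_le[OF assms(2,3)] by blast
qed

lemma has_wirt_hoelder_on:
  assumes "compact S" "convex S" "\<And>z. z \<in> S \<Longrightarrow> has_wirt f (A z) (B z) z"
    "continuous_on S A" "continuous_on S B" "0 < \<alpha>" "\<alpha> \<le> 1"
  shows "hoelder_on S \<alpha> f"
proof -
  obtain L where L: "\<And>x y. x \<in> S \<Longrightarrow> y \<in> S \<Longrightarrow> cmod (f x - f y) \<le> L * cmod (x - y)"
    using has_wirt_lipschitz_compact[OF assms(1-5)] by blast
  have "hoelder_on S 1 f" using L by (intro hoelder_onI[where C = L]) auto
  then show ?thesis using compact_imp_bounded[OF assms(1)] assms(6,7) by (rule hoelder_on_weaken)
qed

lemma holomorphic_hoelder_on:
  assumes "f holomorphic_on U" "open U" "compact S" "convex S" "S \<subseteq> U" "0 < \<alpha>" "\<alpha> \<le> 1"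
  shows "hoelder_on S \<alpha> f"
proof (rule has_wirt_hoelder_on[OF assms(3,4)])
  show "has_wirt f (deriv f z) 0 z" if "z \<in> S" for z
    using assms that by (intro has_wirt_of_field holomorphic_derivI[of f U]) auto
  show "continuous_on S (deriv f)"
    using assms by (meson continuous_on_subset holomorphic_deriv holomorphic_on_imp_continuous_on)
qed (use assms in auto)

section \<open>Derivatives of the transform\<close>

text \<open>The value \<open>- pi\<close> of the second derivative is the origin of the normalising
  factor \<open>- 1 / pi\<close>.\<close>

lemma has_wirt_cauchy_tr_1:
  obtains H where "H holomorphic_on box l u"
    "\<And>z. z \<in> box l u \<Longrightarrow> has_wirt (cauchy_tr l u (\<lambda>_. 1)) (H z) (- pi) z"
proof -
  obtain H where H: "H holomorphic_on box l u" 
      "\<And>z. z \<in> box l u \<Longrightarrow> cauchy_tr l u (\<lambda>_. 1) z = H z + pi * (z - cnj z)"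
    by (rule cauchy_tr_1[of l u]) (rule that, assumption, blast)
  show thesis
  proof
    show "(\<lambda>z. deriv H z + pi) holomorphic_on box l u"
      by (intro holomorphic_intros holomorphic_deriv H(1) open_box)
    fix z assume z: "z \<in> box l u"
    have "has_wirt H (deriv H z) 0 z"
      using z by (intro has_wirt_of_field holomorphic_derivI[OF H(1)] open_box)
    from has_wirt_add[OF this has_wirt_cmult[OF has_wirt_diff[OF has_wirt_ident has_wirt_cnj[OF has_wirt_ident]]], of pi]
    have "has_wirt (\<lambda>z. H z + pi * (z - cnj z)) (deriv H z + pi) (- pi) z" by simp
    then show "has_wirt (cauchy_tr l u (\<lambda>_. 1)) (deriv H z + pi) (- pi) z"
      by (rule has_wirt_cong[OF _ open_box z]) (simp add: H(2))
  qed
qed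

text \<open>Solves \<open>d_zbar k = g\<close> with control of the other derivative. By the
  expansion, the unnormalised transform has derivatives \<open>G z * H z + S z\<close> and
  \<open>- pi * G z\<close>, where \<open>S\<close> is the Beurling transform. Hoelder continuity is
  claimed only on compact convex subsets because \<open>H\<close> is merely holomorphic inside the
  open box.\<close>

lemma cauchy_transform:
  assumes \<alpha>: "0 < \<alpha>" "\<alpha> \<le> 1" and g: "hoelder_on (cbox l u) \<alpha> g" and ne: "box l u \<noteq> {}"
  obtains k e where "\<And>z. z \<in> box l u \<Longrightarrow> has_wirt k (e z) (g z) z"
    and "\<And>S. compact S \<Longrightarrow> convex S \<Longrightarrow> S \<subseteq> box l u \<Longrightarrow> hoelder_on S (\<alpha> / 2) e"
proof -
  \<comment> \<open>Clamping does not increase distances, so \<open>G\<close> is a global extension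
    of \<open>g\<close> with the same Hoelder constant; the kernel estimates ask for bounds on the
    whole plane.\<close>
  define G where "G = (\<lambda>x. g (clamp l u x))"
  have lu: "\<And>i. i \<in> Basis \<Longrightarrow> l \<bullet> i \<le> u \<bullet> i"
    using ne by (auto simp: box_ne_empty intro: less_imp_le)
  have clamp: "clamp l u x \<in> cbox l u" for x using lu by (rule clamp_in_interval)
  have Gg: "G z = g z" if "z \<in> cbox l u" for z using that by (simp add: G_def)
  obtain C where C: "C \<ge> 0" "\<And>x y. x \<in> cbox l u \<Longrightarrow> y \<in> cbox l u \<Longrightarrow> cmod (g x - g y) \<le> C * cmod (x - y) powr \<alpha>"
    using g by (rule hoelder_onE) (rule that, assumption, blast)
  have hoe: "cmod (G x - G y) \<le> C * cmod (x - y) powr \<alpha>" for x y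
  proof -
    have "cmod (G x - G y) \<le> C * cmod (clamp l u x - clamp l u y) powr \<alpha>"
      unfolding G_def by (intro C clamp)
    also have "\<dots> \<le> C * cmod (x - y) powr \<alpha>"
      using dist_clamps_le_dist_args[of l u x y] \<alpha> C(1) by (intro mult_left_mono powr_mono2) (auto simp: dist_norm)
    finally show ?thesis .
  qed
  have Ghoe: "hoelder_on S \<alpha> G" for S using hoe by (rule hoelder_onI)
  have meas: "G \<in> borel_measurable borel"
    using hoelder_on_continuous[OF Ghoe \<alpha>(1)] by (rule borel_measurable_continuous_onI)
  have "bounded (g ` cbox l u)"
    using hoelder_on_continuous[OF g \<alpha>(1)] by (intro compact_imp_bounded compact_continuous_image compact_cbox)
  then obtain M where "\<And>x. x \<in> cbox l u \<Longrightarrow> cmod (g x) \<le> M" unfolding bounded_iff by blast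
  then have M: "\<And>x. cmod (G x) \<le> M" using clamp by (simp add: G_def)
  let ?K = "cauchy_tr l u G" and ?K1 = "cauchy_tr l u (\<lambda>_. 1)" and ?S = "beurling_tr l u G"
  obtain D where D: "\<And>z z'. cmod (?K z' - ?K z - G z * (?K1 z' - ?K1 z) - (z' - z) * ?S z)
      \<le> D * cmod (z' - z) powr (1 + \<alpha> / 2)"
    using cauchy_tr_expansion[OF \<alpha> meas M hoe] by blast
  obtain H where H: "H holomorphic_on box l u" "\<And>z. z \<in> box l u \<Longrightarrow> has_wirt ?K1 (H z) (- pi) z"
    by (rule has_wirt_cauchy_tr_1[of l u]) (rule that, assumption, blast)
  define e where "e z = - (1 / pi) * (G z * H z + ?S z)" for z
  show thesis
  proof
    fix z assume z: "z \<in> box l u"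
    \<comment> \<open>The expansion with \<open>z\<close> frozen: what is subtracted carries the
      whole first-order part of \<open>?K\<close>, the remainder being of order above 1.\<close>
    have "has_wirt (\<lambda>w. ?K w - G z * ?K1 w - ?S z * w) 0 0 z"
      by (rule has_wirt_zeroI[where \<beta> = "\<alpha> / 2" and D = D]) (use D[of _ z] \<alpha> in \<open>simp_all add: algebra_simps\<close>)
    from has_wirt_add[OF this has_wirt_add[OF has_wirt_cmult[OF H(2)[OF z], of "G z"] has_wirt_cmult[OF has_wirt_ident, of "?S z"]]]
    have "has_wirt ?K (G z * H z + ?S z) (- pi * G z) z" by (simp add: mult.commute)
    from has_wirt_cmult[OF this, of "- (1 / pi)"]
    show "has_wirt (\<lambda>w. - (1 / pi) * ?K w) (e z) (g z) z"
      using z Gg[of z] box_subset_cbox[of l u] by (auto simp: e_def subset_iff)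
  next
    fix S assume S: "compact S" "convex S" "S \<subseteq> box l u"
    have hH: "hoelder_on S (\<alpha> / 2) H"
      using \<alpha> by (intro holomorphic_hoelder_on[OF H(1) open_box S]) auto
    have "continuous_on S H" using H(1) S(3) holomorphic_on_imp_continuous_on holomorphic_on_subset by blast
    then obtain L where L: "\<And>x y. x \<in> S \<Longrightarrow> y \<in> S \<Longrightarrow> cmod (?K1 x - ?K1 y) \<le> L * cmod (x - y)"
      using has_wirt_lipschitz_compact[OF S(1,2) H(2)[OF subsetD[OF S(3)]] _ continuous_on_const] by blast
    \<comment> \<open>Expanding around \<^term>\<open>x\<close> and around \<^term>\<open>y\<close> and adding, the increments of the
      Cauchy transform cancel.\<close>
    have "hoelder_on S (\<alpha> / 2) ?S"
    proof -
      obtain d where d: "\<And>x y. x \<in> S \<Longrightarrow> y \<in> S \<Longrightarrow> dist x y \<le> d"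
        using compact_imp_bounded[OF S(1)] unfolding bounded_two_points by blast
      show ?thesis
      proof (rule hoelder_onI[where C = "C * \<bar>L\<bar> * d powr (\<alpha> / 2) + 2 * D"])
        fix x y assume xy: "x \<in> S" "y \<in> S"
        let ?r = "cmod (x - y)"
        show "cmod (?S x - ?S y) \<le> (C * \<bar>L\<bar> * d powr (\<alpha> / 2) + 2 * D) * ?r powr (\<alpha> / 2)"
        proof (cases "x = y")
          case False
          then have r: "?r > 0" by simp
          have tri: "cmod (a + b - c * d) \<le> cmod a + cmod b + cmod c * cmod d" for a b c d :: complex
            using norm_triangle_ineq4[of "a + b" "c * d"] norm_triangle_ineq[of a b] by (simp add: norm_mult)
          let ?a = "?K y - ?K x - G x * (?K1 y - ?K1 x) - (y - x) * ?S x"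
          let ?b = "?K x - ?K y - G y * (?K1 x - ?K1 y) - (x - y) * ?S y"
          have "(x - y) * (?S x - ?S y) = ?a + ?b - (G x - G y) * (?K1 x - ?K1 y)"
            by (simp add: algebra_simps)
          then have "?r * cmod (?S x - ?S y) = cmod (?a + ?b - (G x - G y) * (?K1 x - ?K1 y))"
            by (metis norm_mult)
          also have "\<dots> \<le> cmod ?a + cmod ?b + cmod (G x - G y) * cmod (?K1 x - ?K1 y)"
            by (rule tri)
          also have "\<dots> \<le> D * ?r powr (1 + \<alpha> / 2) + D * ?r powr (1 + \<alpha> / 2) + (C * ?r powr \<alpha>) * (\<bar>L\<bar> * ?r)"
          proof (intro add_mono mult_mono hoe)
            show "cmod ?a \<le> D * ?r powr (1 + \<alpha> / 2)" using D[of y x] by (simp add: norm_minus_commute)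
            show "cmod ?b \<le> D * ?r powr (1 + \<alpha> / 2)" by (rule D)
            show "cmod (?K1 x - ?K1 y) \<le> \<bar>L\<bar> * ?r"
              using L[OF xy] mult_right_mono[OF abs_ge_self, of ?r L] by simp
          qed (use C(1) in auto)
          also have "\<dots> = ?r * ((C * \<bar>L\<bar> * ?r powr (\<alpha> / 2) + 2 * D) * ?r powr (\<alpha> / 2))"
          proof -
            have 1: "?r powr (1 + \<alpha> / 2) = ?r * ?r powr (\<alpha> / 2)" using r by (simp add: powr_add)
            have 2: "?r powr \<alpha> = ?r powr (\<alpha> / 2) * ?r powr (\<alpha> / 2)" using r by (simp add: powr_add[symmetric])
            show ?thesis unfolding 1 2 by (simp add: algebra_simps)
          qed
          finally have "cmod (?S x - ?S y) \<le> (C * \<bar>L\<bar> * ?r powr (\<alpha> / 2) + 2 * D) * ?r powr (\<alpha> / 2)"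
            using r by (simp only: mult_le_cancel_left_pos)
          also have "\<dots> \<le> (C * \<bar>L\<bar> * d powr (\<alpha> / 2) + 2 * D) * ?r powr (\<alpha> / 2)"
            using d[OF xy] \<alpha> C(1) by (intro mult_right_mono add_mono mult_left_mono powr_mono2) (auto simp: dist_norm)
          finally show ?thesis .
        qed simp
      qed
    qed
    moreover have "hoelder_on S (\<alpha> / 2) G"
      by (rule hoelder_on_weaken[OF Ghoe compact_imp_bounded[OF S(1)]]) (use \<alpha> in auto)
    ultimately show "hoelder_on S (\<alpha> / 2) e"
      unfolding e_def using \<alpha> S(1) by (intro hoelder_on_mult hoelder_on_add hoelder_on_const hH) auto
  qed
qed

section \<open>Elliptic regularity\<close>

lemma C1_on_hoelder_on:
  assumes "C1_on \<Omega> f" "compact S" "convex S" "S \<subseteq> \<Omega>" "0 < \<alpha>" "\<alpha> \<le> 1"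
  shows "hoelder_on S \<alpha> f"
  using C1_on_wirtD(1)[OF assms(1) subsetD[OF assms(4)]]
    continuous_on_subset[OF C1_on_wirtD(2)[OF assms(1)] assms(4)]
    continuous_on_subset[OF C1_on_wirtD(3)[OF assms(1)] assms(4)] assms(5,6)
  by (rule has_wirt_hoelder_on[OF assms(2,3)])

text \<open>No more smoothness can be expected in general: \<^term>\<open>d_z W\<close> need not be differentiable.\<close>

lemma d_z_locally_hoelder:
  assumes \<Omega>: "open \<Omega>" "z0 \<in> \<Omega>" and W: "C1_on \<Omega> W" and g: "C1_on \<Omega> (d_zbar W)"
  obtains r where "r > 0" "cball z0 r \<subseteq> \<Omega>" "hoelder_on (cball z0 r) (1 / 2) (d_z W)"
proof -
  obtain l u where lu: "cbox l u \<subseteq> \<Omega>" "z0 \<in> box l u" using open_contains_cbox[OF \<Omega>] by metis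
  then have ne: "box l u \<noteq> {}" and sub: "box l u \<subseteq> \<Omega>" using box_subset_cbox by blast+
  have "hoelder_on (cbox l u) 1 (d_zbar W)"
    using lu(1) by (intro C1_on_hoelder_on[OF g] compact_cbox convex_box) auto
  then obtain k e where ke: "\<And>z. z \<in> box l u \<Longrightarrow> has_wirt k (e z) (d_zbar W z) z"
    "\<And>S. compact S \<Longrightarrow> convex S \<Longrightarrow> S \<subseteq> box l u \<Longrightarrow> hoelder_on S (1 / 2) e"
    using cauchy_transform[of 1 l u "d_zbar W"] ne by auto
  \<comment> \<open>\<open>W\<close> and \<open>k\<close> have the same \<open>d_zbar\<close>, so
    \<open>F\<close> is holomorphic and \<open>d_z W\<close> is \<open>e\<close> plus a holomorphic
    function.\<close>
  define F where "F z = W z - k z" for z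
  have F: "(F has_field_derivative d_z W z - e z) (at z)" if "z \<in> box l u" for z
  proof -
    have "has_wirt F (d_z W z - e z) (d_zbar W z - d_zbar W z) z"
      unfolding F_def using that sub by (intro has_wirt_diff C1_on_wirtD(1)[OF W] ke(1)) auto
    then show ?thesis by (intro has_field_derivative_of_wirt) simp
  qed
  then have "F holomorphic_on box l u"
    unfolding holomorphic_on_open[OF open_box] by blast
  then have dF: "deriv F holomorphic_on box l u" by (intro holomorphic_deriv) auto
  obtain r where r: "r > 0" "cball z0 r \<subseteq> box l u"
    using lu(2) open_contains_cball[of "box l u"] open_box by blast
  show thesis
  proof (rule that[OF r(1)])
    show "cball z0 r \<subseteq> \<Omega>" using r sub by blast
    have "hoelder_on (cball z0 r) (1 / 2) (\<lambda>z. e z + deriv F z)"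
      by (intro hoelder_on_add ke(2) r holomorphic_hoelder_on[OF dF]) auto
    then show "hoelder_on (cball z0 r) (1 / 2) (d_z W)"
      by (rule hoelder_on_cong) (use DERIV_imp_deriv[OF F] r(2) in auto)
  qed
qed

text \<open>Here \<^term>\<open>q = d_z u\<close>, where \<^term>\<open>u\<close> solves the equation of divergence form with coefficient
  \<^term>\<open>1 / \<phi>\<close> and \<^term>\<open>v\<close> is conjugate to \<^term>\<open>u\<close>. Formally
  \<^term>\<open>d_zbar q z = - (cnj (Q0 z) * q z + Q0 z * cnj (q z))\<close>, so \<^term>\<open>q\<close> should differ from the Cauchy transform
  \<^term>\<open>k\<close> of the right-hand side by a holomorphic function. As \<^term>\<open>q\<close> is not known to be differentiable,
  one exhibits instead a holomorphic primitive \<^term>\<open>M\<close> of \<^term>\<open>q - k\<close>.\<close>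

lemma gradient_has_wirt_locally:
  assumes \<Omega>: "open \<Omega>" and Q0: "C1_on \<Omega> Q0" "\<And>z. z \<in> \<Omega> \<Longrightarrow> Im (d_zbar Q0 z) = 0"
    and \<phi>: "\<And>z. z \<in> \<Omega> \<Longrightarrow> has_wirt \<phi> (- 2 * Q0 z * \<phi> z) (- 2 * cnj (Q0 z) * \<phi> z) z"
    and p: "\<And>z. z \<in> \<Omega> \<Longrightarrow> \<phi> z * p z = 1"
    and u: "\<And>z. z \<in> \<Omega> \<Longrightarrow> has_wirt u (q z) (cnj (q z)) z"
    and v: "\<And>z. z \<in> \<Omega> \<Longrightarrow> has_wirt v (- \<i> * p z * q z) (\<i> * p z * cnj (q z)) z"
    and r: "r > 0" "cball z0 r \<subseteq> \<Omega>" and hq: "hoelder_on (cball z0 r) (1 / 2) q"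
  obtains s e where "s > 0" "ball z0 s \<subseteq> \<Omega>" "continuous_on (ball z0 s) e"
    "\<And>z. z \<in> ball z0 s \<Longrightarrow> has_wirt q (e z) (- (cnj (Q0 z) * q z + Q0 z * cnj (q z))) z"
proof -
  define h where "h z = - (cnj (Q0 z) * q z + Q0 z * cnj (q z))" for z
  obtain lo hi where lu: "cbox lo hi \<subseteq> ball z0 r" "z0 \<in> box lo hi"
    using open_contains_cbox[of "ball z0 r" z0] r by (metis centre_in_ball open_ball)
  have sub: "cbox lo hi \<subseteq> cball z0 r" using lu(1) ball_subset_cball by blast
  have hQ: "hoelder_on (cbox lo hi) (1 / 2) Q0"
    using sub r(2) by (intro C1_on_hoelder_on[OF Q0(1)] compact_cbox convex_box) auto
  have hq': "hoelder_on (cbox lo hi) (1 / 2) q" using hq sub by (rule hoelder_on_subset)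
  have "hoelder_on (cbox lo hi) (1 / 2) (\<lambda>z. (- 1) * (cnj (Q0 z) * q z + Q0 z * cnj (q z)))"
    by (intro hoelder_on_mult hoelder_on_add hoelder_on_const hoelder_on_cnj hQ hq' compact_cbox) auto
  then have hh: "hoelder_on (cbox lo hi) (1 / 2) h"
    by (rule hoelder_on_cong) (simp add: h_def)
  have ne: "box lo hi \<noteq> {}" using lu(2) by blast
  obtain k e where ke: "\<And>z. z \<in> box lo hi \<Longrightarrow> has_wirt k (e z) (h z) z"
    "\<And>S. compact S \<Longrightarrow> convex S \<Longrightarrow> S \<subseteq> box lo hi \<Longrightarrow> hoelder_on S (1 / 4) e"
    using cauchy_transform[OF _ _ hh ne, simplified] by blast
  obtain s where s: "s > 0" "cball z0 s \<subseteq> box lo hi"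
    using lu(2) open_contains_cball[of "box lo hi"] open_box by blast
  let ?U = "ball z0 s"
  have Ub: "?U \<subseteq> box lo hi" using s(2) ball_subset_cball by blast
  then have U\<Omega>: "?U \<subseteq> \<Omega>" using box_subset_cbox sub r(2) by blast
  have ce: "continuous_on ?U e"
    by (rule continuous_on_subset[OF hoelder_on_continuous[OF ke(2)[OF compact_cball convex_cball s(2)]] ball_subset_cball]) simp
  have cq: "continuous_on ?U q"
    by (rule continuous_on_subset[OF hoelder_on_continuous[OF hq'] order_trans[OF Ub box_subset_cbox]]) simp
  have ch: "continuous_on ?U h"
    unfolding h_def using continuous_on_subset[OF C1_on_wirtD(4)[OF Q0(1)] U\<Omega>] by (intro continuous_intros cq)
  have kU: "has_wirt k (e z) (h z) z" if "z \<in> ?U" for z using ke(1) that Ub by blast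
  have c\<Omega>: "continuous_on ?U Q0" "continuous_on ?U (d_z Q0)" "continuous_on ?U (d_zbar Q0)"
    "continuous_on ?U \<phi>" "continuous_on ?U v"
    using C1_on_wirtD(2-4)[OF Q0(1)] continuous_on_has_wirt[OF \<phi>] continuous_on_has_wirt[OF v]
      U\<Omega> continuous_on_subset by blast+
  have cp: "continuous_on ?U p"
  proof -
    have "continuous_on ?U (\<lambda>z. inverse (\<phi> z))"
      using p U\<Omega> by (intro continuous_intros c\<Omega>) force
    then show ?thesis
      by (rule continuous_on_eq) (use p U\<Omega> in \<open>auto intro!: inverse_unique\<close>)
  qed
  \<comment> \<open>Since \<open>\<phi> * p = 1\<close>, the function
    \<open>(u + \<i> * \<phi> * v) / 2\<close> has Wirtinger derivatives
    \<open>q - \<i> * \<phi> * v * Q0\<close> and \<open>- \<i> * \<phi> * v * cnj Q0\<close>. So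
    \<open>\<alpha>\<close> and \<open>\<beta>\<close> are what must be removed from it to leave
    \<open>q - k\<close> and 0. Unlike \<open>q\<close>, they are already known to be
    differentiable.\<close>
  define \<alpha> where "\<alpha> z = - \<i> * (v z * (\<phi> z * Q0 z)) + k z" for z
  define \<beta> where "\<beta> z = - \<i> * (v z * (\<phi> z * cnj (Q0 z)))" for z
  define \<alpha>1 where "\<alpha>1 z = - \<i> * (- \<i> * p z * q z * (\<phi> z * Q0 z) + v z * (- 2 * Q0 z * \<phi> z * Q0 z + \<phi> z * d_z Q0 z)) + e z" for z
  define \<alpha>2 where "\<alpha>2 z = - \<i> * (\<i> * p z * cnj (q z) * (\<phi> z * Q0 z) + v z * (- 2 * cnj (Q0 z) * \<phi> z * Q0 z + \<phi> z * d_zbar Q0 z)) + h z" for z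
  define \<beta>1 where "\<beta>1 z = - \<i> * (- \<i> * p z * q z * (\<phi> z * cnj (Q0 z)) + v z * (- 2 * Q0 z * \<phi> z * cnj (Q0 z) + \<phi> z * cnj (d_zbar Q0 z)))" for z
  define \<beta>2 where "\<beta>2 z = - \<i> * (\<i> * p z * cnj (q z) * (\<phi> z * cnj (Q0 z)) + v z * (- 2 * cnj (Q0 z) * \<phi> z * cnj (Q0 z) + \<phi> z * cnj (d_z Q0 z)))" for z
  obtain N where N: "\<And>z. z \<in> ?U \<Longrightarrow> has_wirt N (\<alpha> z) (\<beta> z) z"
  proof (rule poincare_convex[OF open_ball[of z0 s] convex_ball[of z0 s], of \<alpha> \<alpha>1 \<alpha>2 \<beta> \<beta>1 \<beta>2])
    fix z assume z: "z \<in> ?U"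
    then have z\<Omega>: "z \<in> \<Omega>" using U\<Omega> by blast
    note Q = C1_on_wirtD(1)[OF Q0(1) z\<Omega>]
    show "has_wirt \<alpha> (\<alpha>1 z) (\<alpha>2 z) z"
      unfolding \<alpha>_def \<alpha>1_def \<alpha>2_def
      by (intro has_wirt_add has_wirt_cmult has_wirt_mult v \<phi> Q kU z z\<Omega>)
    show "has_wirt \<beta> (\<beta>1 z) (\<beta>2 z) z"
      unfolding \<beta>_def \<beta>1_def \<beta>2_def
      by (intro has_wirt_cmult has_wirt_mult has_wirt_cnj v \<phi> Q z\<Omega>)
    \<comment> \<open>Reality of \<open>d_zbar Q0\<close> cancels its occurrences in
      \<open>\<alpha>2\<close> and \<open>\<beta>1\<close>; the rest of the difference vanishes by
      the choice of \<open>h\<close> as the \<open>d_zbar\<close> of \<open>k\<close>.\<close>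
    have real: "cnj (d_zbar Q0 z) = d_zbar Q0 z" using Q0(2)[OF z\<Omega>] by (simp add: complex_eq_iff)
    have 1: "p z * cnj (q z) * (\<phi> z * Q0 z) = cnj (q z) * Q0 z" "p z * q z * (\<phi> z * cnj (Q0 z)) = q z * cnj (Q0 z)"
      using p[OF z\<Omega>] by algebra+
    show "\<alpha>2 z = \<beta>1 z"
    proof -
      have "\<alpha>2 z - \<beta>1 z = p z * cnj (q z) * (\<phi> z * Q0 z) + p z * q z * (\<phi> z * cnj (Q0 z)) + h z"
        unfolding \<alpha>2_def \<beta>1_def real by (simp add: algebra_simps)
      also have "\<dots> = 0" unfolding 1 h_def by (simp add: algebra_simps)
      finally show ?thesis by simp
    qed
  next
    show "continuous_on ?U \<alpha>1" "continuous_on ?U \<alpha>2" "continuous_on ?U \<beta>1" "continuous_on ?U \<beta>2"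
      unfolding \<alpha>1_def \<alpha>2_def \<beta>1_def \<beta>2_def by (intro continuous_intros c\<Omega> cp cq ch ce)+
  qed blast
  define M where "M z = (1 / 2) * (u z + \<i> * (\<phi> z * v z)) - N z" for z
  have M: "(M has_field_derivative q z - k z) (at z)" if z: "z \<in> ?U" for z
  proof (rule has_field_derivative_of_wirt, rule has_wirt_eq)
    have z\<Omega>: "z \<in> \<Omega>" using U\<Omega> z by blast
    show "has_wirt M ((1 / 2) * (q z + \<i> * (- 2 * Q0 z * \<phi> z * v z + \<phi> z * (- \<i> * p z * q z))) - \<alpha> z)
        ((1 / 2) * (cnj (q z) + \<i> * (- 2 * cnj (Q0 z) * \<phi> z * v z + \<phi> z * (\<i> * p z * cnj (q z)))) - \<beta> z) z"
      unfolding M_def by (intro has_wirt_diff has_wirt_cmult has_wirt_add has_wirt_mult u v \<phi> z\<Omega> N z)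
    have 1: "\<phi> z * (- \<i> * p z * q z) = - \<i> * q z" "\<phi> z * (\<i> * p z * cnj (q z)) = \<i> * cnj (q z)"
      using p[OF z\<Omega>] by algebra+
    show "(1 / 2) * (q z + \<i> * (- 2 * Q0 z * \<phi> z * v z + \<phi> z * (- \<i> * p z * q z))) - \<alpha> z = q z - k z"
      unfolding 1 \<alpha>_def by (simp add: algebra_simps)
    show "(1 / 2) * (cnj (q z) + \<i> * (- 2 * cnj (Q0 z) * \<phi> z * v z + \<phi> z * (\<i> * p z * cnj (q z)))) - \<beta> z = 0"
      unfolding 1 \<beta>_def by (simp add: algebra_simps)
  qed
  then have "M holomorphic_on ?U" unfolding holomorphic_on_open[OF open_ball] by blast
  then have dM: "deriv M holomorphic_on ?U" "deriv (deriv M) holomorphic_on ?U"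
    by (auto intro!: holomorphic_deriv)
  show thesis
  proof (rule that[OF s(1) U\<Omega>])
    show "continuous_on ?U (\<lambda>z. e z + deriv (deriv M) z)"
      by (intro continuous_intros ce holomorphic_on_imp_continuous_on dM)
    fix z assume z: "z \<in> ?U"
    have "has_wirt (deriv M) (deriv (deriv M) z) 0 z"
      by (intro has_wirt_of_field holomorphic_derivI[OF dM(1) open_ball z])
    \<comment> \<open>\<open>q\<close> equals \<open>k + deriv M\<close>, and this sum is
      differentiable although \<open>q\<close> was only assumed Hoelder continuous.\<close>
    from has_wirt_add[OF kU[OF z] this]
    have "has_wirt (\<lambda>w. k w + deriv M w) (e z + deriv (deriv M) z) (h z) z" by simp
    then have "has_wirt q (e z + deriv (deriv M) z) (h z) z"
      by (rule has_wirt_cong[OF _ open_ball z]) (use DERIV_imp_deriv[OF M] in auto)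
    then show "has_wirt q (e z + deriv (deriv M) z) (- (cnj (Q0 z) * q z + Q0 z * cnj (q z))) z"
      by (simp only: h_def)
  qed
qed

section \<open>Riccati and Vekua equations\<close>

lemma riccati_solutionD:
  assumes "riccati_solution \<Omega> \<nu> Q"
  shows "C1_on \<Omega> Q" "\<And>z. z \<in> \<Omega> \<Longrightarrow> d_zbar Q z = of_real (\<nu> z / 4) - Q z * cnj (Q z)"
    "\<And>z. z \<in> \<Omega> \<Longrightarrow> Im (d_zbar Q z) = 0"
proof -
  show 1: "C1_on \<Omega> Q" using assms by (simp add: riccati_solution_def)
  show 2: "d_zbar Q z = of_real (\<nu> z / 4) - Q z * cnj (Q z)" if "z \<in> \<Omega>" for z
    using assms that unfolding riccati_solution_def complex_norm_square by (metis add_diff_cancel_right')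
  show "Im (d_zbar Q z) = 0" if "z \<in> \<Omega>" for z
    unfolding 2[OF that] by (simp add: complex_mult_cnj)
qed

text \<open>Subtracting the two Riccati equations eliminates \<open>\<nu>\<close>. Then
  \<open>d_z \<Phi>\<close> is \<open>\<i> * E z\<close> times the difference of
  \<open>Q0 z * cnj (Q z)\<close> and its conjugate, where \<open>E z\<close> is real, hence a real
  number.\<close>

lemma conjugate_form_closed:
  assumes \<Omega>: "open \<Omega>" and Q: "riccati_solution \<Omega> \<nu> Q" and Q0: "riccati_solution \<Omega> \<nu> Q0"
    and a0: "\<And>z. z \<in> \<Omega> \<Longrightarrow> has_wirt (\<lambda>w. complex_of_real (a0 w)) (Q0 z) (cnj (Q0 z)) z"
    and d: "\<And>z. z \<in> \<Omega> \<Longrightarrow> has_wirt (\<lambda>w. complex_of_real (d w)) (Q z - Q0 z) (cnj (Q z - Q0 z)) z"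
  defines "\<Phi> \<equiv> (\<lambda>z. \<i> * complex_of_real (exp (2 * a0 z)) * d_zbar (\<lambda>w. complex_of_real (exp (d w))) z)"
  shows "C1_on \<Omega> \<Phi>" "\<And>z. z \<in> \<Omega> \<Longrightarrow> Im (d_z \<Phi> z) = 0"
    "\<And>z. z \<in> \<Omega> \<Longrightarrow> \<Phi> z = \<i> * of_real (exp (2 * a0 z + d z)) * cnj (Q z - Q0 z)"
proof -
  define E where "E z = exp (2 * complex_of_real (a0 z) + complex_of_real (d z))" for z
  define \<Psi> where "\<Psi> z = \<i> * (E z * cnj (Q z - Q0 z))" for z
  have Ereal: "E z = of_real (exp (2 * a0 z + d z))" for z
    by (simp add: E_def exp_of_real[symmetric])
  have \<Phi>\<Psi>: "\<Phi> z = \<Psi> z" if z: "z \<in> \<Omega>" for z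
  proof -
    have "d_zbar (\<lambda>w. complex_of_real (exp (d w))) z = exp (of_real (d z)) * cnj (Q z - Q0 z)"
      using partial_wirt(4)[OF has_wirt_exp[OF d[OF z]]] by (simp only: exp_of_real)
    then show ?thesis
      by (simp add: \<Phi>_def \<Psi>_def Ereal exp_add exp_of_real)
  qed
  then show "\<And>z. z \<in> \<Omega> \<Longrightarrow> \<Phi> z = \<i> * of_real (exp (2 * a0 z + d z)) * cnj (Q z - Q0 z)"
    by (simp add: \<Psi>_def Ereal)
  note C = riccati_solutionD(1)[OF Q] riccati_solutionD(1)[OF Q0]
  define A where "A z = \<i> * (E z * (2 * Q0 z + (Q z - Q0 z)) * cnj (Q z - Q0 z) + E z * cnj (d_zbar Q z - d_zbar Q0 z))" for z
  define B where "B z = \<i> * (E z * (2 * cnj (Q0 z) + cnj (Q z - Q0 z)) * cnj (Q z - Q0 z) + E z * cnj (d_z Q z - d_z Q0 z))" for z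
  have E: "has_wirt E (E z * (2 * Q0 z + (Q z - Q0 z))) (E z * (2 * cnj (Q0 z) + cnj (Q z - Q0 z))) z" if "z \<in> \<Omega>" for z
    unfolding E_def by (intro has_wirt_exp has_wirt_add has_wirt_cmult a0 d that)
  have \<Psi>: "has_wirt \<Psi> (A z) (B z) z" if "z \<in> \<Omega>" for z
    unfolding \<Psi>_def A_def B_def
    by (intro has_wirt_cmult has_wirt_mult has_wirt_cnj has_wirt_diff E C1_on_wirtD(1)[OF C(1)] C1_on_wirtD(1)[OF C(2)] that)
  have \<Phi>: "has_wirt \<Phi> (A z) (B z) z" if "z \<in> \<Omega>" for z
    by (rule has_wirt_cong[OF \<Psi>[OF that] \<Omega> that]) (simp add: \<Phi>\<Psi>)
  have cE: "continuous_on \<Omega> E" using E by (rule continuous_on_has_wirt)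
  have "continuous_on \<Omega> A" "continuous_on \<Omega> B"
    unfolding A_def B_def by (intro continuous_intros cE C1_on_wirtD(2-4)[OF C(1)] C1_on_wirtD(2-4)[OF C(2)])+
  with \<Phi> show "C1_on \<Omega> \<Phi>" by (rule C1_on_wirtI)
  fix z assume z: "z \<in> \<Omega>"
  have "d_z \<Phi> z = A z" by (rule partial_wirt(3)[OF \<Phi>[OF z]])
  also have "\<dots> = \<i> * (E z * (Q0 z * cnj (Q z) - cnj (Q0 z * cnj (Q z))))"
    unfolding A_def riccati_solutionD(2)[OF Q z] riccati_solutionD(2)[OF Q0 z] by (simp add: algebra_simps)
  finally show "Im (d_z \<Phi> z) = 0" by (simp add: Ereal complex_diff_cnj)
qed

text \<open>\<open>W\<close> is built by the representation formula itself, the A-bar potential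
  being obtained as the potential of \<open>cnj \<Phi>\<close>. Its real part
  \<open>exp (a z)\<close> has logarithmic \<open>d_z\<close>-derivative \<open>Q z\<close>.\<close>

lemma vekua_solution_of_riccati:
  assumes \<Omega>: "open \<Omega>" "simply_connected \<Omega>" and Q: "riccati_solution \<Omega> \<nu> Q" and Q0: "riccati_solution \<Omega> \<nu> Q0"
  obtains W where "vekua_solution \<Omega> Q0 W" "\<And>z. z \<in> \<Omega> \<Longrightarrow> Re (W z) \<noteq> 0"
    "\<And>z. z \<in> \<Omega> \<Longrightarrow> Q z = d_z (\<lambda>w. complex_of_real (Re (W w))) z / complex_of_real (Re (W z))"
proof -
  note RQ = riccati_solutionD[OF Q] and RQ0 = riccati_solutionD[OF Q0]
  obtain a where a: "\<And>z. z \<in> \<Omega> \<Longrightarrow> has_wirt (\<lambda>w. complex_of_real (a w)) (Q z) (cnj (Q z)) z"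
    using poincare_simply_connected[OF \<Omega> RQ(1,3)] by blast
  obtain a0 where a0: "\<And>z. z \<in> \<Omega> \<Longrightarrow> has_wirt (\<lambda>w. complex_of_real (a0 w)) (Q0 z) (cnj (Q0 z)) z"
    using poincare_simply_connected[OF \<Omega> RQ0(1,3)] by blast
  have d: "has_wirt (\<lambda>w. complex_of_real (a w - a0 w)) (Q z - Q0 z) (cnj (Q z - Q0 z)) z" if "z \<in> \<Omega>" for z
    using has_wirt_diff[OF a[OF that] a0[OF that]] by simp
  define \<Phi> where "\<Phi> = (\<lambda>z. \<i> * complex_of_real (exp (2 * a0 z)) * d_zbar (\<lambda>w. complex_of_real (exp (a w - a0 w))) z)"
  have \<Phi>: "C1_on \<Omega> \<Phi>" "\<And>z. z \<in> \<Omega> \<Longrightarrow> Im (d_z \<Phi> z) = 0"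
    "\<And>z. z \<in> \<Omega> \<Longrightarrow> \<Phi> z = \<i> * of_real (exp (2 * a0 z + (a z - a0 z))) * cnj (Q z - Q0 z)"
    unfolding \<Phi>_def by (rule conjugate_form_closed[OF \<Omega>(1) Q Q0 a0 d]; assumption)+
  have cnj\<Phi>: "has_wirt (\<lambda>z. cnj (\<Phi> z)) (cnj (d_zbar \<Phi> z)) (cnj (d_z \<Phi> z)) z" if "z \<in> \<Omega>" for z
    by (intro has_wirt_cnj C1_on_wirtD(1)[OF \<Phi>(1)] that)
  have "C1_on \<Omega> (\<lambda>z. cnj (\<Phi> z))"
    by (rule C1_on_wirtI[OF cnj\<Phi>]) (auto intro!: continuous_intros C1_on_wirtD[OF \<Phi>(1)])
  moreover have "Im (d_zbar (\<lambda>z. cnj (\<Phi> z)) z) = 0" if "z \<in> \<Omega>" for z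
    using partial_wirt(4)[OF cnj\<Phi>[OF that]] \<Phi>(2)[OF that] by simp
  ultimately obtain b where b: "\<And>z. z \<in> \<Omega> \<Longrightarrow> has_wirt (\<lambda>w. complex_of_real (b w)) (cnj (\<Phi> z)) (\<Phi> z) z"
    using poincare_simply_connected[OF \<Omega>, of "\<lambda>z. cnj (\<Phi> z)"] by auto
  define F where "F z = exp (complex_of_real (a z))" for z
  define G where "G z = exp (- 1 * complex_of_real (a0 z))" for z
  define W where "W z = F z + \<i> * (G z * of_real (b z))" for z
  have FG: "F z = of_real (exp (a z))" "G z = of_real (exp (- a0 z))" for z
    by (simp_all add: F_def G_def exp_of_real[symmetric])
  define A where "A z = F z * Q z + \<i> * (G z * (- 1 * Q0 z) * of_real (b z) + G z * cnj (\<Phi> z))" for z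
  define B where "B z = F z * cnj (Q z) + \<i> * (G z * (- 1 * cnj (Q0 z)) * of_real (b z) + G z * \<Phi> z)" for z
  have F: "has_wirt F (F z * Q z) (F z * cnj (Q z)) z" if "z \<in> \<Omega>" for z
    unfolding F_def by (intro has_wirt_exp a that)
  have G: "has_wirt G (G z * (- 1 * Q0 z)) (G z * (- 1 * cnj (Q0 z))) z" if "z \<in> \<Omega>" for z
    unfolding G_def by (intro has_wirt_exp has_wirt_cmult a0 that)
  have W: "has_wirt W (A z) (B z) z" if "z \<in> \<Omega>" for z
    unfolding W_def A_def B_def by (intro has_wirt_add has_wirt_cmult has_wirt_mult F G b that)
  have ReW: "Re (W z) = exp (a z)" for z
    by (simp add: W_def FG)
  have B: "B z = cnj (Q0 z * W z)" if "z \<in> \<Omega>" for z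
  proof -
    have "G z * \<Phi> z = \<i> * of_real (exp (- a0 z) * exp (2 * a0 z + (a z - a0 z))) * cnj (Q z - Q0 z)"
      by (simp add: \<Phi>(3)[OF that] FG)
    also have "exp (- a0 z) * exp (2 * a0 z + (a z - a0 z)) = exp (a z)"
      by (simp add: exp_add[symmetric])
    \<comment> \<open>Multiplied by \<open>\<i>\<close>, this turns \<open>F z * cnj (Q z)\<close>
      in \<open>B z\<close> into \<open>F z * cnj (Q0 z)\<close>, so that \<open>cnj (Q0 z)\<close>
      factors out.\<close>
    finally have G\<Phi>: "G z * \<Phi> z = \<i> * F z * cnj (Q z - Q0 z)" by (simp add: FG)
    show ?thesis
      unfolding B_def W_def G\<Phi> by (simp add: FG algebra_simps)
  qed
  show thesis
  proof
    show "vekua_solution \<Omega> Q0 W"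
      unfolding vekua_solution_def
    proof (intro conjI ballI)
      have c: "continuous_on \<Omega> F" "continuous_on \<Omega> G" "continuous_on \<Omega> (\<lambda>z. complex_of_real (b z))"
        by (rule continuous_on_has_wirt[OF F] continuous_on_has_wirt[OF G] continuous_on_has_wirt[OF b]; assumption)+
      have "continuous_on \<Omega> A" "continuous_on \<Omega> B"
        unfolding A_def B_def
        by (intro continuous_intros c C1_on_wirtD(4)[OF RQ(1)] C1_on_wirtD(4)[OF RQ0(1)] C1_on_wirtD(4)[OF \<Phi>(1)])+
      with W show "C1_on \<Omega> W" by (rule C1_on_wirtI)
      show "d_zbar W z = cnj (Q0 z * W z)" if "z \<in> \<Omega>" for z
        using partial_wirt(4)[OF W[OF that]] B[OF that] by simp
    qed
    show "Re (W z) \<noteq> 0" for z by (simp add: ReW)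
    show "Q z = d_z (\<lambda>w. complex_of_real (Re (W w))) z / complex_of_real (Re (W z))" if "z \<in> \<Omega>" for z
    proof -
      have "(\<lambda>w. complex_of_real (Re (W w))) = F" by (simp add: ReW FG fun_eq_iff)
      then show ?thesis using partial_wirt(3)[OF F[OF that]] by (simp add: ReW FG)
    qed
  qed
qed

text \<open>The first two claims are the Vekua equation written as a conjugacy of the real functions
  \<open>u\<close> and \<open>v\<close>; they need only one derivative of \<open>W\<close>. Both
  regularity steps are local, and the results agree because Wirtinger derivatives are
  unique.\<close>

lemma vekua_gradient_C1_on:
  assumes \<Omega>: "open \<Omega>" and Q0: "riccati_solution \<Omega> \<nu> Q0" and W: "vekua_solution \<Omega> Q0 W"
    and a0: "\<And>z. z \<in> \<Omega> \<Longrightarrow> has_wirt (\<lambda>w. complex_of_real (a0 w)) (Q0 z) (cnj (Q0 z)) z"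
  defines "q \<equiv> (\<lambda>z. exp (- complex_of_real (a0 z)) * ((d_z W z - Q0 z * cnj (W z)) / 2))"
  shows "\<And>z. z \<in> \<Omega> \<Longrightarrow> has_wirt (\<lambda>w. complex_of_real (Re (W w) * exp (- a0 w))) (q z) (cnj (q z)) z"
    and "\<And>z. z \<in> \<Omega> \<Longrightarrow> has_wirt (\<lambda>w. complex_of_real (Im (W w) * exp (a0 w)))
           (- \<i> * of_real (exp (2 * a0 z)) * q z) (\<i> * of_real (exp (2 * a0 z)) * cnj (q z)) z"
    and "C1_on \<Omega> q"
    and "\<And>z. z \<in> \<Omega> \<Longrightarrow> d_zbar q z = - (cnj (Q0 z) * q z + Q0 z * cnj (q z))"
proof -
  note RQ0 = riccati_solutionD[OF Q0]
  have C1W: "C1_on \<Omega> W" and Wzb: "\<And>z. z \<in> \<Omega> \<Longrightarrow> d_zbar W z = cnj (Q0 z * W z)"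
    using W by (auto simp: vekua_solution_def)
  have dW: "has_wirt W (d_z W z) (cnj (Q0 z * W z)) z" if "z \<in> \<Omega>" for z
    using C1_on_wirtD(1)[OF C1W that] Wzb[OF that] by simp
  define e where "e c z = exp (c * complex_of_real (a0 z))" for c :: complex and z
  have e: "has_wirt (e c) (e c z * (c * Q0 z)) (e c z * (c * cnj (Q0 z))) z" if "z \<in> \<Omega>" for c z
    unfolding e_def by (intro has_wirt_exp has_wirt_cmult a0 that)
  have ee: "e c z * e c' z = e (c + c') z" for c c' z
    by (simp add: e_def exp_add[symmetric] distrib_right)
  have ereal: "e (of_real c) z = of_real (exp (c * a0 z))" for c z
    by (simp add: e_def exp_of_real[symmetric])
  have e1: "e 1 z = of_real (exp (a0 z))" "e (- 1) z = of_real (exp (- a0 z))" "e 2 z = of_real (exp (2 * a0 z))" for z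
    using ereal[of 1 z] ereal[of "-1" z] ereal[of 2 z] by simp_all
  have ecnj: "cnj (e (- 1) z) = e (- 1) z" for z by (simp add: e1)
  have q: "q z = e (- 1) z * ((d_z W z - Q0 z * cnj (W z)) / 2)" for z
    by (simp add: q_def e_def)
  have cnjq: "cnj (q z) = e (- 1) z * ((cnj (d_z W z) - cnj (Q0 z) * W z) / 2)" for z
    by (simp add: q e1)
  have u: "has_wirt (\<lambda>w. complex_of_real (Re (W w) * exp (- a0 w))) (q z) (cnj (q z)) z" if z: "z \<in> \<Omega>" for z
  proof -
    have R: "complex_of_real (Re (W z)) = (W z + cnj (W z)) / 2" by (simp add: complex_add_cnj)
    have "has_wirt (\<lambda>w. complex_of_real (Re (W w)) * e (- 1) w) (q z) (cnj (q z)) z"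
      by (rule has_wirt_eq[OF has_wirt_mult[OF has_wirt_Re[OF dW[OF z]] e[OF z]]])
         (unfold q cnjq R, simp_all add: ecnj field_simps)
    then show ?thesis by (simp add: e1)
  qed
  have v: "has_wirt (\<lambda>w. complex_of_real (Im (W w) * exp (a0 w))) (- \<i> * e 2 z * q z) (\<i> * e 2 z * cnj (q z)) z" if z: "z \<in> \<Omega>" for z
  proof -
    have I: "complex_of_real (Im (W z)) = - \<i> * ((W z - cnj (W z)) / 2)" by (simp add: complex_eq_iff)
    have p: "e 2 z * e (- 1) z = e 1 z" by (simp add: ee)
    have p1: "- \<i> * e 2 z * q z = - \<i> * e 1 z * ((d_z W z - Q0 z * cnj (W z)) / 2)"
      "\<i> * e 2 z * cnj (q z) = \<i> * e 1 z * ((cnj (d_z W z) - cnj (Q0 z) * W z) / 2)"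
      by (simp_all only: cnjq p[symmetric] mult.assoc) (simp only: q mult.assoc)
    have "has_wirt (\<lambda>w. complex_of_real (Im (W w)) * e 1 w) (- \<i> * e 2 z * q z) (\<i> * e 2 z * cnj (q z)) z"
      by (rule has_wirt_eq[OF has_wirt_mult[OF has_wirt_Im[OF dW[OF z]] e[OF z]]])
         (unfold p1 I, simp_all add: ecnj field_simps)
    then show ?thesis by (simp add: e1)
  qed
  show "has_wirt (\<lambda>w. complex_of_real (Re (W w) * exp (- a0 w))) (q z) (cnj (q z)) z" if "z \<in> \<Omega>" for z
    using u that .
  show "has_wirt (\<lambda>w. complex_of_real (Im (W w) * exp (a0 w)))
      (- \<i> * of_real (exp (2 * a0 z)) * q z) (\<i> * of_real (exp (2 * a0 z)) * cnj (q z)) z" if "z \<in> \<Omega>" for z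
    using v[OF that] by (simp only: e1)
  have local: "\<exists>s A. s > 0 \<and> ball z0 s \<subseteq> \<Omega> \<and> continuous_on (ball z0 s) A \<and>
      (\<forall>z\<in>ball z0 s. has_wirt q (A z) (- (cnj (Q0 z) * q z + Q0 z * cnj (q z))) z)" if z0: "z0 \<in> \<Omega>" for z0
  proof -
    \<comment> \<open>Start of the bootstrap: the right-hand side of the Vekua equation is a product
      of C1 functions.\<close>
    have "C1_on \<Omega> (d_zbar W)"
    proof (rule C1_on_wirtI)
      show "has_wirt (d_zbar W) (cnj (d_zbar Q0 z * W z + Q0 z * cnj (Q0 z * W z))) (cnj (d_z Q0 z * W z + Q0 z * d_z W z)) z"
        if z: "z \<in> \<Omega>" for z
        by (rule has_wirt_cong[OF has_wirt_cnj[OF has_wirt_mult[OF C1_on_wirtD(1)[OF RQ0(1) z] dW[OF z]]] \<Omega> z])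
           (simp add: Wzb)
      show "continuous_on \<Omega> (\<lambda>z. cnj (d_zbar Q0 z * W z + Q0 z * cnj (Q0 z * W z)))"
        "continuous_on \<Omega> (\<lambda>z. cnj (d_z Q0 z * W z + Q0 z * d_z W z))"
        by (intro continuous_intros C1_on_wirtD(2-4)[OF RQ0(1)] C1_on_wirtD(2-4)[OF C1W])+
    qed
    then obtain r where r: "r > 0" "cball z0 r \<subseteq> \<Omega>" "hoelder_on (cball z0 r) (1 / 2) (d_z W)"
      using d_z_locally_hoelder[OF \<Omega> z0 C1W] by blast
    have "C1_on \<Omega> (e (- 1))"
      by (rule C1_on_wirtI[OF e]) (auto intro!: continuous_intros continuous_on_has_wirt[OF e] C1_on_wirtD(4)[OF RQ0(1)])
    then have hh: "hoelder_on (cball z0 r) (1 / 2) (e (- 1))" "hoelder_on (cball z0 r) (1 / 2) Q0" "hoelder_on (cball z0 r) (1 / 2) W"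
      using C1_on_hoelder_on[OF _ compact_cball convex_cball r(2)] RQ0(1) C1W by auto
    have "hoelder_on (cball z0 r) (1 / 2) (\<lambda>z. e (- 1) z * ((1 / 2) * (d_z W z + (- 1) * (Q0 z * cnj (W z)))))"
      by (intro hoelder_on_mult hoelder_on_add hoelder_on_cnj hoelder_on_const hh r(3)) auto
    then have hq: "hoelder_on (cball z0 r) (1 / 2) q"
      by (rule hoelder_on_cong) (simp add: q)
    have \<phi>: "has_wirt (e (- 2)) (- 2 * Q0 z * e (- 2) z) (- 2 * cnj (Q0 z) * e (- 2) z) z" if "z \<in> \<Omega>" for z
      by (rule has_wirt_eq[OF e[OF that]]) simp_all
    have p: "e (- 2) z * e 2 z = 1" for z by (simp add: ee e_def exp_add[symmetric])
    show ?thesis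
      using gradient_has_wirt_locally[OF \<Omega> RQ0(1,3) \<phi> p u v r(1,2) hq] by metis
  qed
  show "C1_on \<Omega> q" "\<And>z. z \<in> \<Omega> \<Longrightarrow> d_zbar q z = - (cnj (Q0 z) * q z + Q0 z * cnj (q z))"
  proof -
    show db: "d_zbar q z = - (cnj (Q0 z) * q z + Q0 z * cnj (q z))" if "z \<in> \<Omega>" for z
      using local[OF that] partial_wirt(4) by (metis centre_in_ball)
    have hw: "has_wirt q (d_z q z) (- (cnj (Q0 z) * q z + Q0 z * cnj (q z))) z" if "z \<in> \<Omega>" for z
      using local[OF that] partial_wirt(3) by (metis centre_in_ball)
    show "C1_on \<Omega> q"
    proof (rule C1_on_wirtI[OF hw])
      show "continuous_on \<Omega> (\<lambda>z. - (cnj (Q0 z) * q z + Q0 z * cnj (q z)))"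
        by (intro continuous_intros C1_on_wirtD(4)[OF RQ0(1)] continuous_on_has_wirt[OF hw])
      show "continuous_on \<Omega> (d_z q)"
      proof (intro continuous_at_imp_continuous_on ballI)
        fix z assume "z \<in> \<Omega>"
        then obtain s A where s: "s > 0" "continuous_on (ball z s) A"
          "\<And>w. w \<in> ball z s \<Longrightarrow> has_wirt q (A w) (- (cnj (Q0 w) * q w + Q0 w * cnj (q w))) w"
          using local by blast
        have "continuous_on (ball z s) (d_z q)"
          by (rule continuous_on_eq[OF s(2)]) (simp add: partial_wirt(3)[OF s(3)])
        then show "isCont (d_z q) z" using s(1) by (simp add: continuous_on_eq_continuous_at)
      qed
    qed
  qed
qed

text \<open>With \<open>u = exp (- a0) * Re W\<close> one has \<open>Q = Q0 + q / u\<close>, so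
  regularity of \<open>q\<close> passes to \<open>Q\<close> and the equation for
  \<open>d_zbar q\<close> becomes the Riccati equation.\<close>

lemma riccati_of_vekua_solution:
  assumes \<Omega>: "open \<Omega>" "\<Omega> \<noteq> {}" "simply_connected \<Omega>" and Q0: "riccati_solution \<Omega> \<nu> Q0"
    and W: "vekua_solution \<Omega> Q0 W" and Re: "\<And>z. z \<in> \<Omega> \<Longrightarrow> Re (W z) \<noteq> 0"
  defines "Q \<equiv> (\<lambda>z. d_z (\<lambda>w. complex_of_real (Re (W w))) z / complex_of_real (Re (W z)))"
  obtains a a0 d b where "riccati_solution \<Omega> \<nu> Q" "is_A \<Omega> Q a" "is_A \<Omega> Q0 a0" "is_A \<Omega> (\<lambda>z. Q z - Q0 z) d"
    "is_A_bar \<Omega> (\<lambda>z. \<i> * complex_of_real (exp (2 * a0 z)) * d_zbar (\<lambda>w. complex_of_real (exp (d w))) z) b"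
    "\<And>z. z \<in> \<Omega> \<Longrightarrow> W z = complex_of_real (sgn (Re (W z))) *
        (complex_of_real (exp (a z)) + \<i> * complex_of_real (exp (- a0 z)) * complex_of_real (b z))"
proof -
  note RQ0 = riccati_solutionD[OF Q0]
  have C1W: "C1_on \<Omega> W" and Wzb: "\<And>z. z \<in> \<Omega> \<Longrightarrow> d_zbar W z = cnj (Q0 z * W z)"
    using W by (auto simp: vekua_solution_def)
  have dW: "has_wirt W (d_z W z) (cnj (Q0 z * W z)) z" if "z \<in> \<Omega>" for z
    using C1_on_wirtD(1)[OF C1W that] Wzb[OF that] by simp
  obtain a0 where a0: "\<And>z. z \<in> \<Omega> \<Longrightarrow> has_wirt (\<lambda>w. complex_of_real (a0 w)) (Q0 z) (cnj (Q0 z)) z"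
    using poincare_simply_connected[OF \<Omega>(1,3) RQ0(1,3)] by blast
  define q where "q = (\<lambda>z. exp (- complex_of_real (a0 z)) * ((d_z W z - Q0 z * cnj (W z)) / 2))"
  define u where "u z = complex_of_real (Re (W z) * exp (- a0 z))" for z
  define p where "p z = complex_of_real (exp (2 * a0 z))" for z
  have reg: "\<And>z. z \<in> \<Omega> \<Longrightarrow> has_wirt u (q z) (cnj (q z)) z"
    "\<And>z. z \<in> \<Omega> \<Longrightarrow> has_wirt (\<lambda>w. complex_of_real (Im (W w) * exp (a0 w))) (- \<i> * p z * q z) (\<i> * p z * cnj (q z)) z"
    "C1_on \<Omega> q"
    "\<And>z. z \<in> \<Omega> \<Longrightarrow> d_zbar q z = - (cnj (Q0 z) * q z + Q0 z * cnj (q z))"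
    unfolding q_def u_def p_def by (rule vekua_gradient_C1_on[OF \<Omega>(1) Q0 W a0]; assumption)+
  have u0: "u z \<noteq> 0" if "z \<in> \<Omega>" for z using Re[OF that] by (simp add: u_def)
  have cnju: "cnj (u z) = u z" for z by (simp add: u_def)
  have dq: "has_wirt q (d_z q z) (- (cnj (Q0 z) * q z + Q0 z * cnj (q z))) z" if "z \<in> \<Omega>" for z
    using C1_on_wirtD(1)[OF reg(3) that] reg(4)[OF that] by simp
  have R: "complex_of_real (Re (W z)) = (W z + cnj (W z)) / 2" for z by (simp add: complex_add_cnj)
  have dR: "has_wirt (\<lambda>w. complex_of_real (Re (W w))) ((d_z W z + Q0 z * W z) / 2) (cnj ((d_z W z + Q0 z * W z) / 2)) z" if "z \<in> \<Omega>" for z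
    using has_wirt_Re[OF dW[OF that]] by (simp add: add.commute)
  have Qz: "Q z = ((d_z W z + Q0 z * W z) / 2) / complex_of_real (Re (W z))" if "z \<in> \<Omega>" for z
    by (simp only: Q_def partial_wirt(3)[OF dR[OF that]])
  have Qq: "Q z = Q0 z + q z * inverse (u z)" if "z \<in> \<Omega>" for z
  proof -
    have "q z * inverse (u z) = ((d_z W z - Q0 z * cnj (W z)) / 2) / complex_of_real (Re (W z))"
      using Re[OF that] by (simp add: q_def u_def exp_of_real[symmetric] field_simps)
    then have "Q0 z + q z * inverse (u z) = (Q0 z * complex_of_real (Re (W z)) + (d_z W z - Q0 z * cnj (W z)) / 2) / complex_of_real (Re (W z))"
      using Re[OF that] by (simp add: field_simps)
    also have "Q0 z * complex_of_real (Re (W z)) + (d_z W z - Q0 z * cnj (W z)) / 2 = (d_z W z + Q0 z * W z) / 2"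
      unfolding R by (simp add: field_simps)
    finally show ?thesis using Qz[OF that] by simp
  qed
  define A where "A z = d_z Q0 z + (d_z q z * inverse (u z) + q z * (- q z / (u z)\<^sup>2))" for z
  define B where "B z = d_zbar Q0 z + (- (cnj (Q0 z) * q z + Q0 z * cnj (q z)) * inverse (u z) + q z * (- cnj (q z) / (u z)\<^sup>2))" for z
  have dQ: "has_wirt Q (A z) (B z) z" if z: "z \<in> \<Omega>" for z
  proof (rule has_wirt_cong[OF _ \<Omega>(1) z])
    show "has_wirt (\<lambda>z. Q0 z + q z * inverse (u z)) (A z) (B z) z"
      unfolding A_def B_def by (intro has_wirt_add has_wirt_mult has_wirt_inverse C1_on_wirtD(1)[OF RQ0(1)] dq reg(1) u0 z)
  qed (simp add: Qq)
  have "continuous_on \<Omega> A" "continuous_on \<Omega> B"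
    unfolding A_def B_def using u0
    by (auto intro!: continuous_intros C1_on_wirtD(2-4)[OF RQ0(1)] C1_on_wirtD(2-4)[OF reg(3)] continuous_on_has_wirt[OF reg(1)])
  with dQ have C1Q: "C1_on \<Omega> Q" by (rule C1_on_wirtI)
  have ric: "riccati_solution \<Omega> \<nu> Q"
    unfolding riccati_solution_def
  proof (intro conjI C1Q ballI)
    fix z assume z: "z \<in> \<Omega>"
    \<comment> \<open>As \<open>u\<close> is real, the terms in \<open>q\<close> complete the
      squared modulus of \<open>Q0\<close> to that of \<open>Q0 + q / u\<close>.\<close>
    have "d_zbar Q z + Q z * cnj (Q z) = of_real (\<nu> z / 4)"
      unfolding partial_wirt(4)[OF dQ[OF z]] B_def RQ0(2)[OF z] Qq[OF z]
      using u0[OF z] by (simp add: cnju power2_eq_square field_simps)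
    then show "d_zbar Q z + of_real ((cmod (Q z))\<^sup>2) = of_real (\<nu> z / 4)"
      by (simp only: complex_norm_square)
  qed
  \<comment> \<open>The logarithm of the modulus of \<open>Re W\<close>; squaring treats both signs
    at once and keeps the argument of the complex \<open>Ln\<close> off its branch cut.\<close>
  define a where "a z = ln ((Re (W z))\<^sup>2) / 2" for z
  have expa: "exp (a z) = \<bar>Re (W z)\<bar>" if "z \<in> \<Omega>" for z
  proof -
    have "a z = ln \<bar>Re (W z)\<bar>"
      using Re[OF that] ln_realpow[of "\<bar>Re (W z)\<bar>" 2] by (simp add: a_def)
    then show ?thesis using Re[OF that] by simp
  qed
  have da: "has_wirt (\<lambda>w. complex_of_real (a w)) (Q z) (cnj (Q z)) z" if z: "z \<in> \<Omega>" for z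
  proof (rule has_wirt_cong[OF _ \<Omega>(1) z])
    let ?R = "\<lambda>w. complex_of_real (Re (W w))" and ?D = "(d_z W z + Q0 z * W z) / 2"
    have "?R z * ?R z \<notin> \<real>\<^sub>\<le>\<^sub>0"
      using Re[OF z] by (auto simp: complex_nonpos_Reals_iff power2_eq_square[symmetric] not_le)
    then have "(Ln has_field_derivative inverse (?R z * ?R z)) (at (?R z * ?R z))"
      by (rule has_field_derivative_Ln)
    note w = has_wirt_cmult[OF has_wirt_field_comp[OF has_wirt_mult[OF dR[OF z] dR[OF z]] this], of "1 / 2"]
    show "has_wirt (\<lambda>w. 1 / 2 * Ln (?R w * ?R w)) (Q z) (cnj (Q z)) z"
      by (rule has_wirt_eq[OF w]) (use Re[OF z] in \<open>simp_all add: Qz[OF z] field_simps\<close>)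
    show "1 / 2 * Ln (?R w * ?R w) = complex_of_real (a w)" if "w \<in> \<Omega>" for w
    proof -
      have "Ln (complex_of_real ((Re (W w))\<^sup>2)) = of_real (ln ((Re (W w))\<^sup>2))"
        using Re[OF that] by (intro Ln_of_real) simp
      then show ?thesis by (simp add: a_def power2_eq_square)
    qed
  qed
  \<comment> \<open>The additive constants must match: with this choice of A[Q - Q0],
    \<open>exp d\<close> is the modulus of \<open>u\<close>.\<close>
  define d where "d z = a z - a0 z" for z
  have dd: "has_wirt (\<lambda>w. complex_of_real (d w)) (Q z - Q0 z) (cnj (Q z - Q0 z)) z" if "z \<in> \<Omega>" for z
    using has_wirt_diff[OF da[OF that] a0[OF that]] by (simp add: d_def)
  define \<Phi> where "\<Phi> = (\<lambda>z. \<i> * complex_of_real (exp (2 * a0 z)) * d_zbar (\<lambda>w. complex_of_real (exp (d w))) z)"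
  have \<Phi>: "C1_on \<Omega> \<Phi>" "\<And>z. z \<in> \<Omega> \<Longrightarrow> Im (d_z \<Phi> z) = 0"
    "\<And>z. z \<in> \<Omega> \<Longrightarrow> \<Phi> z = \<i> * of_real (exp (2 * a0 z + d z)) * cnj (Q z - Q0 z)"
    unfolding \<Phi>_def by (rule conjugate_form_closed[OF \<Omega>(1) ric Q0 a0 dd]; assumption)+
  define b where "b z = sgn (Re (W z)) * (Im (W z) * exp (a0 z))" for z
  have db: "has_wirt (\<lambda>w. complex_of_real (b w)) (cnj (\<Phi> z)) (\<Phi> z) z" if z: "z \<in> \<Omega>" for z
  proof (rule has_wirt_cong)
    let ?\<sigma> = "sgn (Re (W z))"
    \<comment> \<open>A neighbourhood of \<open>z\<close> on which \<open>Re W\<close> keeps its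
      sign, so that \<open>sgn\<close> acts there as a constant factor.\<close>
    let ?T = "\<Omega> \<inter> (\<lambda>w. Re (W w) * ?\<sigma>) -` {0<..}"
    show "open ?T"
      using C1_on_wirtD(4)[OF C1W] \<Omega>(1) by (intro continuous_open_preimage continuous_intros) auto
    show "z \<in> ?T" using z Re[OF z] by (simp add: sgn_if)
    show "complex_of_real ?\<sigma> * complex_of_real (Im (W w) * exp (a0 w)) = complex_of_real (b w)" if "w \<in> ?T" for w
    proof -
      have "sgn (Re (W w)) = ?\<sigma>" using that Re[OF z] by (auto simp: sgn_if split: if_splits)
      then show ?thesis by (simp add: b_def)
    qed
    have \<Phi>z: "\<Phi> z = of_real ?\<sigma> * (\<i> * p z * cnj (q z))"
    proof -
      have "exp (2 * a0 z + d z) = exp (2 * a0 z) * (\<bar>Re (W z)\<bar> * exp (- a0 z))"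
        unfolding expa[OF z, symmetric] by (simp add: exp_add[symmetric] d_def)
      also have "\<dots> = exp (2 * a0 z) * (?\<sigma> * (Re (W z) * exp (- a0 z)))"
        by (simp add: sgn_if)
      finally have 1: "complex_of_real (exp (2 * a0 z + d z)) = p z * (of_real ?\<sigma> * u z)"
        by (simp add: p_def u_def)
      have 2: "cnj (Q z - Q0 z) = cnj (q z) * inverse (u z)"
        by (simp add: Qq[OF z] cnju)
      show ?thesis
        unfolding \<Phi>(3)[OF z] 1 2 using u0[OF z] by (simp add: field_simps)
    qed
    have cnj\<Phi>: "cnj (\<Phi> z) = of_real ?\<sigma> * (- \<i> * p z * q z)"
      unfolding \<Phi>z by (simp add: p_def)
    show "has_wirt (\<lambda>w. complex_of_real ?\<sigma> * complex_of_real (Im (W w) * exp (a0 w))) (cnj (\<Phi> z)) (\<Phi> z) z"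
      unfolding cnj\<Phi> unfolding \<Phi>z by (intro has_wirt_cmult reg(2) z)
  qed
  have C1d: "C1_on \<Omega> (\<lambda>z. Q z - Q0 z)" and Imd: "\<And>z. z \<in> \<Omega> \<Longrightarrow> Im (d_zbar (\<lambda>z. Q z - Q0 z) z) = 0"
  proof -
    have w: "has_wirt (\<lambda>z. Q z - Q0 z) (d_z Q z - d_z Q0 z) (d_zbar Q z - d_zbar Q0 z) z" if "z \<in> \<Omega>" for z
      by (intro has_wirt_diff C1_on_wirtD(1)[OF C1Q] C1_on_wirtD(1)[OF RQ0(1)] that)
    show "C1_on \<Omega> (\<lambda>z. Q z - Q0 z)"
      by (rule C1_on_wirtI[OF w]) (auto intro!: continuous_intros C1_on_wirtD(2,3)[OF C1Q] C1_on_wirtD(2,3)[OF RQ0(1)])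
    show "Im (d_zbar (\<lambda>z. Q z - Q0 z) z) = 0" if "z \<in> \<Omega>" for z
      using partial_wirt(4)[OF w[OF that]] riccati_solutionD(3)[OF ric that] RQ0(3)[OF that] by simp
  qed
  show thesis
  proof (rule that[OF ric])
    show "is_A \<Omega> Q a" by (rule is_A_potential[OF \<Omega>(1,2) C1Q da riccati_solutionD(3)[OF ric]])
    show "is_A \<Omega> Q0 a0" by (rule is_A_potential[OF \<Omega>(1,2) RQ0(1) a0 RQ0(3)])
    show "is_A \<Omega> (\<lambda>z. Q z - Q0 z) d" by (rule is_A_potential[OF \<Omega>(1,2) C1d dd Imd])
    show "is_A_bar \<Omega> (\<lambda>z. \<i> * complex_of_real (exp (2 * a0 z)) * d_zbar (\<lambda>w. complex_of_real (exp (d w))) z) b"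
      unfolding \<Phi>_def[symmetric] by (rule is_A_bar_potential[OF \<Omega>(1,2) \<Phi>(1) db \<Phi>(2)])
    fix z assume z: "z \<in> \<Omega>"
    have "sgn (Re (W z)) * exp (a z) = Re (W z)" "sgn (Re (W z)) * (exp (- a0 z) * b z) = Im (W z)"
    proof -
      show "sgn (Re (W z)) * exp (a z) = Re (W z)" by (simp add: expa[OF z] sgn_mult_abs)
      have "sgn (Re (W z)) * sgn (Re (W z)) = 1" using Re[OF z] by (simp add: sgn_if)
      moreover have "exp (- a0 z) * exp (a0 z) = 1" by (simp add: exp_add[symmetric])
      ultimately show "sgn (Re (W z)) * (exp (- a0 z) * b z) = Im (W z)"
        unfolding b_def by algebra
    qed
    then show "W z = complex_of_real (sgn (Re (W z))) *
        (complex_of_real (exp (a z)) + \<i> * complex_of_real (exp (- a0 z)) * complex_of_real (b z))"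
      by (simp add: complex_eq_iff algebra_simps)
  qed
qed

text \<open>\<open>W\<close> and \<open>- W\<close> solve the same real-linear equation and give the
  same \<open>Q\<close>, but \<open>exp\<close> reaches only positive real parts; hence the factor
  \<open>sgn (Re (W z))\<close>. The potentials are quantified jointly because their additive
  constants have to be matched to the given \<open>W\<close>.\<close>

theorem theorem9:
  fixes \<Omega> :: "complex set" and \<nu> :: "complex \<Rightarrow> real" and Q0 :: "complex \<Rightarrow> complex"
  assumes "open \<Omega>" and "\<Omega> \<noteq> {}" and "simply_connected \<Omega>"
    and "riccati_solution \<Omega> \<nu> Q0" and "bounded (Q0 ` \<Omega>)"
  shows
    "(\<forall>Q. riccati_solution \<Omega> \<nu> Q \<longrightarrow>
        (\<exists>W. vekua_solution \<Omega> Q0 W \<and>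
          (\<forall>z\<in>\<Omega>. Re (W z) \<noteq> 0 \<and>
             Q z = d_z (\<lambda>w. complex_of_real (Re (W w))) z / complex_of_real (Re (W z))))) \<and>
     (\<forall>W. vekua_solution \<Omega> Q0 W \<and> (\<forall>z\<in>\<Omega>. Re (W z) \<noteq> 0) \<longrightarrow>
        (\<exists>Q. riccati_solution \<Omega> \<nu> Q \<and>
          (\<forall>z\<in>\<Omega>. Q z = d_z (\<lambda>w. complex_of_real (Re (W w))) z / complex_of_real (Re (W z))) \<and>
          (\<exists>a a0 d b.
             is_A \<Omega> Q a \<and> is_A \<Omega> Q0 a0 \<and> is_A \<Omega> (\<lambda>z. Q z - Q0 z) d \<and>
             is_A_bar \<Omega> (\<lambda>z. \<i> * complex_of_real (exp (2 * a0 z)) *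
                              d_zbar (\<lambda>w. complex_of_real (exp (d w))) z) b \<and>
             (\<forall>z\<in>\<Omega>. W z = complex_of_real (sgn (Re (W z))) *
                (complex_of_real (exp (a z)) +
                 \<i> * complex_of_real (exp (- a0 z)) * complex_of_real (b z))))))"
proof (intro conjI allI impI)
  fix Q assume "riccati_solution \<Omega> \<nu> Q"
  then show "\<exists>W. vekua_solution \<Omega> Q0 W \<and> (\<forall>z\<in>\<Omega>. Re (W z) \<noteq> 0 \<and>
      Q z = d_z (\<lambda>w. complex_of_real (Re (W w))) z / complex_of_real (Re (W z)))"
    using vekua_solution_of_riccati[OF assms(1,3) _ assms(4)] by metis
next
  fix W assume "vekua_solution \<Omega> Q0 W \<and> (\<forall>z\<in>\<Omega>. Re (W z) \<noteq> 0)"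
  then have W: "vekua_solution \<Omega> Q0 W" "\<forall>z\<in>\<Omega>. Re (W z) \<noteq> 0" by auto
  let ?Q = "\<lambda>z. d_z (\<lambda>w. complex_of_real (Re (W w))) z / complex_of_real (Re (W z))"
  obtain a a0 d b where "riccati_solution \<Omega> \<nu> ?Q" "is_A \<Omega> ?Q a" "is_A \<Omega> Q0 a0" "is_A \<Omega> (\<lambda>z. ?Q z - Q0 z) d"
    "is_A_bar \<Omega> (\<lambda>z. \<i> * complex_of_real (exp (2 * a0 z)) * d_zbar (\<lambda>w. complex_of_real (exp (d w))) z) b"
    "\<And>z. z \<in> \<Omega> \<Longrightarrow> W z = complex_of_real (sgn (Re (W z))) *
        (complex_of_real (exp (a z)) + \<i> * complex_of_real (exp (- a0 z)) * complex_of_real (b z))"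
    using riccati_of_vekua_solution[OF assms(1-4) W(1)] W(2) by blast
  then show "\<exists>Q. riccati_solution \<Omega> \<nu> Q \<and>
      (\<forall>z\<in>\<Omega>. Q z = d_z (\<lambda>w. complex_of_real (Re (W w))) z / complex_of_real (Re (W z))) \<and>
      (\<exists>a a0 d b.
         is_A \<Omega> Q a \<and> is_A \<Omega> Q0 a0 \<and> is_A \<Omega> (\<lambda>z. Q z - Q0 z) d \<and>
         is_A_bar \<Omega> (\<lambda>z. \<i> * complex_of_real (exp (2 * a0 z)) *
                          d_zbar (\<lambda>w. complex_of_real (exp (d w))) z) b \<and>
         (\<forall>z\<in>\<Omega>. W z = complex_of_real (sgn (Re (W z))) *
            (complex_of_real (exp (a z)) +
             \<i> * complex_of_real (exp (- a0 z)) * complex_of_real (b z))))"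
    by (intro exI[of _ ?Q] exI[of _ a] exI[of _ a0] exI[of _ d] exI[of _ b] conjI ballI refl) blast+
qed

end
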